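(* Let $x>0$, let $\sigma,\mu,\xi,\zeta,\vartheta,l,m,s\in\mathbb{C}$, $\eta,\nu,k\in\mathbb{R}$ and $q\in\mathbb{R}^+$, with $\Re(\sigma)>0$, $\Re(\xi)>0$, $\Re(\zeta)>0$, $\Re(\vartheta)>0$, $\Re(\mu)>0$, $\Re(l)>0$, $\Re(m)>0$, $\Re(s)>0$, $\eta>0$ (the parameter $m$ does not occur in the formula). Assume that $\frac{\xi}{k}$, $\frac{\nu}{\eta}$ and $\nu$ are positive real numbers and $1+\frac{\xi}{k}-q-\nu\ge 0$, and that the left-hand side below is defined and the Fox-Wright series on the right-hand side converges. Then $$L\left\{z^{l-1}\left({}^{\eta}D^{\sigma}_{0-}\,t^\mu E^{\vartheta,q}_{k,\xi,\zeta}\big((tz)^\nu\big)\right)(x)\right\}=(-1)^{-\sigma}\,\frac{x^{\mu-\sigma\eta}}{s^l}\,\frac{\eta^\sigma}{\Gamma\left(\frac{\vartheta}{k}\right)}\,k^{1-\frac{\zeta}{k}}\;{}_{3}\Psi_{2}\left[\begin{array}{c}\left(\frac{\vartheta}{k},q\right),\ \left(\frac{\mu}{\eta}+1,\frac{\nu}{\eta}\right),\ (l,\nu);\\ \left(\frac{\zeta}{k},\frac{\xi}{k}\right),\ \left(\frac{\mu}{\eta}-\sigma+1,\frac{\nu}{\eta}\right);\end{array}\ k^{\,q-\frac{\xi}{k}}\left(\frac{x}{s}\right)^{\nu}\right],$$ where the Laplace transform is taken with respect to the variable $z$ and evaluated at $s$.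
   Context: The $k$-gamma function is $\Gamma_k(\vartheta)=k^{\frac{\vartheta}{k}-1}\Gamma\left(\frac{\vartheta}{k}\right)$, and the $k$-Pochhammer symbol is $(\vartheta)_{nq,k}=k^{nq}\left(\frac{\vartheta}{k}\right)_{nq}$, where $(a)_{nq}=\Gamma(a+nq)/\Gamma(a)$. The generalized $k$-Mittag-Leffler function is $$E^{\vartheta,q}_{k,\xi,\zeta}(z)=\sum_{n=0}^\infty\frac{(\vartheta)_{nq,k}\,z^n}{\Gamma_k(n\xi+\zeta)\,n!},$$ for $k\in\mathbb{R}$, $\Re(\xi)>0$, $\Re(\zeta)>0$, $\Re(\vartheta)>0$, $q\in\mathbb{R}^+$. The Fox-Wright function is $${}_p\Psi_q\left[\begin{array}{c}(a_1,\xi_1),\dots,(a_p,\xi_p);\\ (b_1,\zeta_1),\dots,(b_q,\zeta_q);\end{array}\ z\right]=\sum_{n=0}^\infty\frac{\prod_{i=1}^p\Gamma(a_i+\xi_i n)}{\prod_{j=1}^q\Gamma(b_j+\zeta_j n)}\frac{z^n}{n!},$$ where $\xi_i,\zeta_j\in\mathbb{R}^+$ and $1+\sum_j\zeta_j-\sum_i\xi_i\ge0$ (here $p,q$ as subscripts of $\Psi$ are the numbers of parameter pairs). As usual $1/\Gamma$ is $0$ at the poles of $\Gamma$. For $\sigma\in\mathbb{C}$, $\Re(\sigma)>0$, $\eta>0$ and $n=[\Re(\sigma)]+1$ (with $[\cdot]$ the integer part), the operator ${}^{\eta}D^{\sigma}_{0-}$ is given by the formula $$\left({}^{\eta}D^{\sigma}_{0-}f(t)\right)(x)=\frac{\eta^{\sigma-n+1}}{\Gamma(n-\sigma)}\left(-x^{1-\eta}\frac{d}{dx}\right)^n\int_x^0\frac{t^{\eta-1}f(t)}{(t^\eta-x^\eta)^{\sigma-n+1}}\,dt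 ,$$ used here at $x>0$, with $\int_x^0=-\int_0^x$ (oriented integral) and complex powers of negative real numbers taken with the principal branch, $(-a)^c=e^{i\pi c}a^c$ for $a>0$; in particular $(-1)^{-\sigma}=e^{-i\pi\sigma}$. It is defined when $f$ is defined on $(0,b)$ for some $b>x$ (in particular any series defining $f$ converges there), the integral converges absolutely for all lower limits near $x$, and the indicated derivatives exist at $x$. Here, for each fixed $z>0$, it acts on $f(t)=t^\mu E^{\vartheta,q}_{k,\xi,\zeta}((tz)^\nu)$ as a function of $t$. The Laplace transform of a function $g(z)$ is $L\{g(z)\}=\int_0^\infty e^{-sz}g(z)\,dz$. Powers of $s$ and $x/s$ use the principal branch. *)

theory Defs
  imports "HOL-Analysis.Analysis"
begin

text \<open>
  Powers are principal values throughout: \<open>w powr c = exp (c * Ln w)\<close> for complex \<open>w \<noteq> 0\<close>, so that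
  \<open>complex_of_real (-a) powr c = exp (\<i> * pi * c) * complex_of_real a powr c\<close> for \<open>a > 0\<close>.
\<close>

definition k_gamma :: "real \<Rightarrow> complex \<Rightarrow> complex" where
  "k_gamma k \<theta> = complex_of_real k powr (\<theta> / of_real k - 1) * Gamma (\<theta> / of_real k)"

text \<open>The library's \<^const>\<open>pochhammer\<close> only covers indices in \<^typ>\<open>nat\<close>; here the index is real.\<close>

definition real_pochhammer :: "complex \<Rightarrow> real \<Rightarrow> complex" where
  "real_pochhammer a r = Gamma (a + of_real r) / Gamma a"

definition k_pochhammer :: "real \<Rightarrow> complex \<Rightarrow> real \<Rightarrow> complex" where
  "k_pochhammer k \<theta> r = complex_of_real k powr of_real r * real_pochhammer (\<theta> / of_real k) r"

definition k_mittag_leffler_term ::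
    "real \<Rightarrow> complex \<Rightarrow> complex \<Rightarrow> complex \<Rightarrow> real \<Rightarrow> complex \<Rightarrow> nat \<Rightarrow> complex" where
  "k_mittag_leffler_term k \<xi> \<zeta> \<theta> q z n =
     k_pochhammer k \<theta> (real n * q) * z ^ n / (k_gamma k (of_nat n * \<xi> + \<zeta>) * fact n)"

definition k_mittag_leffler ::
    "real \<Rightarrow> complex \<Rightarrow> complex \<Rightarrow> complex \<Rightarrow> real \<Rightarrow> complex \<Rightarrow> complex" where
  "k_mittag_leffler k \<xi> \<zeta> \<theta> q z = (\<Sum>n. k_mittag_leffler_term k \<xi> \<zeta> \<theta> q z n)"

text \<open>
  \<^const>\<open>rGamma\<close> is the entire function \<open>1/\<Gamma>\<close>, zero at the poles of \<open>\<Gamma>\<close>.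
  The formula is meaningful only if no numerator argument is a pole of \<open>\<Gamma>\<close>.
\<close>

definition fox_wright_term ::
    "(complex \<times> real) list \<Rightarrow> (complex \<times> real) list \<Rightarrow> complex \<Rightarrow> nat \<Rightarrow> complex" where
  "fox_wright_term as bs z n =
     (\<Prod>(a, \<alpha>)\<leftarrow>as. Gamma (a + of_real \<alpha> * of_nat n)) *
     (\<Prod>(b, \<beta>)\<leftarrow>bs. rGamma (b + of_real \<beta> * of_nat n)) * (z ^ n / fact n)"

definition fox_wright ::
    "(complex \<times> real) list \<Rightarrow> (complex \<times> real) list \<Rightarrow> complex \<Rightarrow> complex" where
  "fox_wright as bs z = (\<Sum>n. fox_wright_term as bs z n)"

definition frac_order :: "complex \<Rightarrow> nat" where
  "frac_order \<sigma> = nat (\<lfloor>Re \<sigma>\<rfloor> + 1)"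

definition frac_integrand :: "real \<Rightarrow> complex \<Rightarrow> (real \<Rightarrow> complex) \<Rightarrow> real \<Rightarrow> real \<Rightarrow> complex" where
  "frac_integrand \<eta> \<sigma> f y t =
     of_real (t powr (\<eta> - 1)) * f t /
       complex_of_real (t powr \<eta> - y powr \<eta>) powr (\<sigma> - of_nat (frac_order \<sigma>) + 1)"

text \<open>For \<open>y > 0\<close> the interval integral below is oriented: it is minus the integral over \<open>(0, y)\<close>.\<close>

definition frac_integral :: "real \<Rightarrow> complex \<Rightarrow> (real \<Rightarrow> complex) \<Rightarrow> real \<Rightarrow> complex" where
  "frac_integral \<eta> \<sigma> f y = (LBINT t=ereal y..ereal 0. frac_integrand \<eta> \<sigma> f y t)"

definition weighted_deriv :: "real \<Rightarrow> (real \<Rightarrow> complex) \<Rightarrow> real \<Rightarrow> complex" where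
  "weighted_deriv \<eta> g y = - of_real (y powr (1 - \<eta>)) * vector_derivative g (at y)"

text \<open>
  \<^const>\<open>vector_derivative\<close> is total, so existence of the \<open>n\<close>-fold weighted derivative at a point is
  recorded separately: every lower iterate exists near the point and the last one is differentiable
  at the point.
\<close>

primrec weighted_deriv_exists :: "real \<Rightarrow> nat \<Rightarrow> (real \<Rightarrow> complex) \<Rightarrow> real \<Rightarrow> bool" where
  "weighted_deriv_exists \<eta> 0 g y \<longleftrightarrow> True"
| "weighted_deriv_exists \<eta> (Suc j) g y \<longleftrightarrow>
     (\<forall>\<^sub>F u in nhds y. weighted_deriv_exists \<eta> j g u) \<and>
     ((weighted_deriv \<eta> ^^ j) g) differentiable (at y)"

definition frac_deriv :: "real \<Rightarrow> complex \<Rightarrow> (real \<Rightarrow> complex) \<Rightarrow> real \<Rightarrow> complex" where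
  "frac_deriv \<eta> \<sigma> f x =
     complex_of_real \<eta> powr (\<sigma> - of_nat (frac_order \<sigma>) + 1) / Gamma (of_nat (frac_order \<sigma>) - \<sigma>) *
     (weighted_deriv \<eta> ^^ frac_order \<sigma>) (frac_integral \<eta> \<sigma> f) x"

text \<open>
  \<open>S\<close> is the set of points at which the expression \<open>f\<close> is defined; it is needed because a function
  given by a series is total in HOL. Interval integrability in the Lebesgue sense is absolute
  convergence.
\<close>

definition frac_deriv_defined ::
    "real set \<Rightarrow> real \<Rightarrow> complex \<Rightarrow> (real \<Rightarrow> complex) \<Rightarrow> real \<Rightarrow> bool" where
  "frac_deriv_defined S \<eta> \<sigma> f x \<longleftrightarrow>
     (\<exists>b>x. {0<..<b} \<subseteq> S) \<and>
     (\<forall>\<^sub>F y in nhds x.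
        interval_lebesgue_integrable lborel (ereal y) (ereal 0) (frac_integrand \<eta> \<sigma> f y)) \<and>
     weighted_deriv_exists \<eta> (frac_order \<sigma>) (frac_integral \<eta> \<sigma> f) x"

text \<open>
  The Henstock-Kurzweil integral is used so that conditionally convergent improper integrals over
  \<open>(0, \<infinity>)\<close> are covered as well as absolutely convergent ones.
\<close>

definition laplace_converges :: "(real \<Rightarrow> complex) \<Rightarrow> complex \<Rightarrow> bool" where
  "laplace_converges g s \<longleftrightarrow> (\<lambda>z. exp (- s * of_real z) * g z) integrable_on {0<..}"

definition laplace :: "(real \<Rightarrow> complex) \<Rightarrow> complex \<Rightarrow> complex" where
  "laplace g s = integral {0<..} (\<lambda>z. exp (- s * of_real z) * g z)"

end

theory Submission
  imports Defs "HOL-Complex_Analysis.Complex_Analysis" "HOL-Real_Asymp.Real_Asymp"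
begin

text \<open>
  Both sides are transforms of one series. Convergence of the Mittag-Leffler series at every
  \<open>t = x\<close> and \<open>z > 0\<close> makes its coefficients those of an entire function, so for fixed \<open>z\<close> the
  operand is a series of monomials \<open>t powr (\<mu> + \<nu> * n)\<close> that may be integrated and differentiated
  termwise. On a monomial the integral is a complex Beta integral after the substitution
  \<open>u = (t / y) powr \<eta>\<close>, and the \<open>N\<close> weighted derivatives, where \<open>N\<close> is the order, multiply by a
  Pochhammer symbol; together they leave
  \<open>\<Gamma>((\<mu> + \<nu> * n) / \<eta> + 1) / \<Gamma>((\<mu> + \<nu> * n) / \<eta> - \<sigma> + 1)\<close> (\<open>frac_deriv_gen_powser\<close>).
  The principal branch at \<open>t powr \<eta> - y powr \<eta> < 0\<close>, the orientation of the integral and the \<open>N\<close>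
  signs of the derivatives combine to \<open>(-1) powr (-\<sigma>)\<close>.

  The delicate step is the Laplace transform (\<open>laplace_gen_powser\<close>), since at \<open>s\<close> neither the
  integral nor the Fox-Wright series need converge absolutely: the argument of the series may lie on
  its circle of convergence. For real \<open>p > |s|\<close> everything is absolutely convergent and the
  transform may be taken termwise; this needs \<open>\<Gamma>(Re z + t)\<close> to be at most a constant times \<open>|\<Gamma>(z + t)|\<close>, which
  follows from comparing a Beta integral with its absolute value (\<open>Gamma_shift_bound\<close>). If \<open>\<Phi>\<close> is the
  primitive of \<open>exp (- s * z) * g z\<close>, then \<open>p \<mapsto> p * \<integral> exp (- p * z) * \<Phi> z\<close> is holomorphic for
  \<open>Re p > 0\<close> because \<open>\<Phi>\<close> is bounded, and integration by parts identifies it with the transform of \<open>g\<close>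
  at \<open>s + p\<close>. By analytic continuation it equals the series on a convex region whose boundary
  contains \<open>s\<close>. Along \<open>s * (1 + 1 / n)\<close> the integral side tends to the value at infinity of \<open>\<Phi>\<close>,
  that is, to the improper integral, and the series side tends to the sum of the series by Abel's
  limit theorem.
\<close>

section \<open>The complex Beta integral\<close>

lemma powr_of_real_mult:
  fixes a b :: real
  assumes "a \<ge> 0" "b \<ge> 0"
  shows "complex_of_real (a * b) powr z = of_real a powr z * of_real b powr z"
  using assms by (simp add: powr_times_real)

lemma norm_powr_of_real:
  fixes a :: real
  assumes "a > 0"
  shows "norm (complex_of_real a powr z) = a powr Re z"
  using assms by (simp add: norm_powr_real_powr)

lemma Gamma_nonzero_right_halfplane:
  fixes z :: complex
  assumes "Re z > 0"
  shows "Gamma z \<noteq> 0"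
  using assms by (auto simp: Gamma_eq_zero_iff elim!: nonpos_Ints_cases)

definition gamma_density :: "complex \<Rightarrow> real \<Rightarrow> complex" where
  "gamma_density z t = indicator {0<..} t *\<^sub>R (of_real t powr (z - 1) / of_real (exp t))"

lemma gamma_density_measurable [measurable]: "gamma_density z \<in> borel_measurable borel"
  unfolding gamma_density_def by measurable

lemma gamma_density_lborel:
  assumes "Re z > 0"
  shows "integrable lborel (gamma_density z)" "integral\<^sup>L lborel (gamma_density z) = Gamma z"
proof -
  let ?f = "\<lambda>t. complex_of_real t powr (z - 1) / of_real (exp t)"
  have "set_integrable lebesgue {0<..} ?f"
    using absolutely_integrable_Gamma_integral'[OF assms] .
  then have "integrable lebesgue (gamma_density z)"
    by (simp add: set_integrable_def gamma_density_def [abs_def])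
  then show i: "integrable lborel (gamma_density z)"
    by (subst (asm) integrable_completion) auto
  then have s: "set_integrable lborel {0<..} ?f"
    by (simp add: set_integrable_def gamma_density_def [abs_def])
  have "integral\<^sup>L lborel (gamma_density z) = (LINT t:{0<..}|lborel. ?f t)"
    by (simp add: set_lebesgue_integral_def gamma_density_def [abs_def])
  also have "\<dots> = integral {0<..} ?f"
    by (rule set_borel_integral_eq_integral(2)[OF s])
  also have "\<dots> = Gamma z"
    by (rule integral_unique[OF Gamma_integral_complex'[OF assms]])
  finally show "integral\<^sup>L lborel (gamma_density z) = Gamma z" .
qed

definition beta_density :: "complex \<Rightarrow> complex \<Rightarrow> real \<Rightarrow> complex" where
  "beta_density a b t = indicator {0<..<1} t *\<^sub>R (of_real t powr (a - 1) * of_real (1 - t) powr (b - 1))"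

lemma beta_density_measurable [measurable]: "beta_density a b \<in> borel_measurable borel"
  unfolding beta_density_def by measurable

lemma beta_density_norm:
  "norm (beta_density a b t) = indicator {0<..<1} t * (t powr (Re a - 1) * (1 - t) powr (Re b - 1))"
  by (auto simp: beta_density_def indicator_def norm_mult norm_powr_of_real simp flip: of_real_diff
      simp del: of_real_diff)

lemma beta_density_integrable:
  assumes "Re a > 0" "Re b > 0"
  shows "integrable lborel (beta_density a b)"
    and "(\<integral>t. norm (beta_density a b t) \<partial>lborel) = Beta (Re a) (Re b)"
proof -
  let ?f = "\<lambda>t::real. t powr (Re a - 1) * (1 - t) powr (Re b - 1)"
  have "(?f has_integral Beta (Re a) (Re b)) {0<..<1}"
    using has_integral_Beta_real[of "Re a" "Re b"] assms by (simp add: has_integral_Icc_iff_Ioo)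
  then have "((\<lambda>t. if t \<in> {0<..<1} then ?f t else 0) has_integral Beta (Re a) (Re b)) UNIV"
    by (simp only: has_integral_restrict_UNIV)
  moreover have "(\<lambda>t. if t \<in> {0<..<1} then ?f t else 0) = (\<lambda>t. norm (beta_density a b t))"
    by (auto simp: beta_density_norm)
  ultimately have *: "((\<lambda>t. norm (beta_density a b t)) has_integral Beta (Re a) (Re b)) UNIV"
    by simp
  then have "has_bochner_integral lborel (\<lambda>t. norm (beta_density a b t)) (Beta (Re a) (Re b))"
    apply (intro has_bochner_integral_nn_integral)
       apply simp
      apply simp
     apply (rule has_integral_nonneg[OF *])
     apply simp
    apply (rule nn_integral_has_integral_lborel)
      apply auto
    done
  then show "(\<integral>t. norm (beta_density a b t) \<partial>lborel) = Beta (Re a) (Re b)"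
     "integrable lborel (beta_density a b)"
    by (auto simp: has_bochner_integral_iff integrable_norm_iff)
qed

text \<open>Scaling by \<open>v\<close> turns the convolution of two Gamma densities at \<open>v\<close> into the Beta density.\<close>

lemma gamma_density_convolution:
  "(\<integral>t. gamma_density a t * gamma_density b (v - t) \<partial>lborel) =
     gamma_density (a + b) v * integral\<^sup>L lborel (beta_density a b)"
proof (cases "v > 0")
  case False
  then have "(\<lambda>t. gamma_density a t * gamma_density b (v - t)) = (\<lambda>t. 0)" "gamma_density (a + b) v = 0"
    by (auto simp: gamma_density_def fun_eq_iff indicator_def)
  then show ?thesis by simp
next
  case True
  have "(\<integral>t. gamma_density a t * gamma_density b (v - t) \<partial>lborel) =
        v *\<^sub>R (\<integral>t. gamma_density a (v * t) * gamma_density b (v - v * t) \<partial>lborel)"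
    using lborel_integral_real_affine[of v "\<lambda>t. gamma_density a t * gamma_density b (v - t)" 0] True
    by simp
  also have "(\<lambda>t. gamma_density a (v * t) * gamma_density b (v - v * t)) =
      (\<lambda>t. of_real v powr (a - 1) * of_real v powr (b - 1) / of_real (exp v) * beta_density a b t)"
  proof
    fix t
    show "gamma_density a (v * t) * gamma_density b (v - v * t) =
      of_real v powr (a - 1) * of_real v powr (b - 1) / of_real (exp v) * beta_density a b t"
    proof (cases "0 < t \<and> t < 1")
      case t: True
      have "complex_of_real (v - v * t) powr (b - 1) = of_real v powr (b - 1) * of_real (1 - t) powr (b - 1)"
        using powr_of_real_mult[of v "1 - t"] True t by (simp add: algebra_simps)
      moreover have "exp v = exp (v * t) * exp (v - v * t)"
        by (simp flip: exp_add)
      ultimately show ?thesis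
        using True t powr_of_real_mult[of v t "a - 1"]
        by (simp add: gamma_density_def beta_density_def)
    next
      case t: False
      then have "\<not> (0 < v * t \<and> 0 < v - v * t)"
        using True by (auto simp: zero_less_mult_iff)
      then have "gamma_density a (v * t) * gamma_density b (v - v * t) = 0" 
        unfolding gamma_density_def indicator_def by auto
      moreover have "beta_density a b t = 0"
        using t by (auto simp: beta_density_def indicator_def)
      ultimately show ?thesis by simp
    qed
  qed
  also have "v *\<^sub>R (\<integral>t. of_real v powr (a - 1) * of_real v powr (b - 1) / of_real (exp v) * beta_density a b t \<partial>lborel)
     = v *\<^sub>R (of_real v powr (a - 1) * of_real v powr (b - 1) / of_real (exp v)) *
         integral\<^sup>L lborel (beta_density a b)"
    by (simp add: scaleR_conv_of_real)
  also have "v *\<^sub>R (of_real v powr (a - 1) * of_real v powr (b - 1) / of_real (exp v)) =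
      gamma_density (a + b) v"
  proof -
    have "complex_of_real v powr (a + b - 1) = of_real v powr ((a - 1) + (b - 1) + 1)"
      by (simp add: algebra_simps)
    also have "\<dots> = of_real v powr (a - 1) * of_real v powr (b - 1) * of_real v"
      using True by (subst powr_add)+ simp
    finally show ?thesis
      using True by (simp add: gamma_density_def scaleR_conv_of_real)
  qed
  finally show ?thesis .
qed

text \<open>The convolution of the Gamma densities for \<open>a\<close> and \<open>b\<close> has total mass \<open>\<Gamma>(a) * \<Gamma>(b)\<close> by Fubini; by
  scaling it is also the density for \<open>a + b\<close> times the Beta integral.\<close>

theorem Beta_integral_complex:
  assumes a: "Re a > 0" and b: "Re b > 0"
  shows "integral\<^sup>L lborel (beta_density a b) = Beta a b"
proof -
  let ?F = "\<lambda>(t, v). gamma_density a t * gamma_density b (v - t)"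
  have shift: "integrable lborel (\<lambda>v. gamma_density b (v - t))" 
    "(\<integral>v. gamma_density b (v - t) \<partial>lborel) = Gamma b" 
    "(\<integral>v. norm (gamma_density b (v - t)) \<partial>lborel) = (\<integral>v. norm (gamma_density b v) \<partial>lborel)" for t
    using lborel_integrable_real_affine[OF gamma_density_lborel(1)[OF b], of 1 "-t"]
      lborel_integral_real_affine[of 1 "gamma_density b" "-t"] gamma_density_lborel(2)[OF b]
      lborel_integral_real_affine[of 1 "\<lambda>v. norm (gamma_density b v)" "-t"]
    by (simp_all add: algebra_simps)
  have int: "integrable (lborel \<Otimes>\<^sub>M lborel) ?F"
  proof (rule lborel_pair.Fubini_integrable)
    show "?F \<in> borel_measurable (lborel \<Otimes>\<^sub>M lborel)"
      by measurable
    show "integrable lborel (\<lambda>t. \<integral>v. norm (?F (t, v)) \<partial>lborel)"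
      using gamma_density_lborel(1)[OF a] by (simp add: norm_mult shift)
    show "AE t in lborel. integrable lborel (\<lambda>v. ?F (t, v))"
      by (simp add: shift)
  qed
  have "Gamma a * Gamma b = (\<integral>t. \<integral>v. ?F (t, v) \<partial>lborel \<partial>lborel)"
    by (simp add: shift gamma_density_lborel a b)
  also have "\<dots> = (\<integral>v. \<integral>t. ?F (t, v) \<partial>lborel \<partial>lborel)"
    using lborel_pair.Fubini_integral[of "\<lambda>t v. ?F (t, v)"] int by simp
  also have "\<dots> = Gamma (a + b) * integral\<^sup>L lborel (beta_density a b)"
    using gamma_density_lborel[of "a + b"] a b by (simp add: gamma_density_convolution)
  finally show ?thesis
    using Gamma_nonzero_right_halfplane[of "a + b"] a b by (simp add: Beta_def field_simps)
qed

text \<open>This is \<open>|Beta z t| \<le> Beta (Re z) t\<close>, the triangle inequality for the Beta integral, with the common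
  factor \<open>\<Gamma>(t)\<close> cancelled. It bounds \<open>|\<Gamma>(z + t)|\<close> from below, uniformly in
  \<open>t\<close>, by its value on the real axis.\<close>

lemma Gamma_shift_bound:
  assumes z: "Re z > 0" and t: "t \<ge> 0"
  shows "Gamma (Re z + t) * norm (Gamma z) \<le> Gamma (Re z) * norm (Gamma (z + of_real t))"
proof (cases "t = 0")
  case False
  with t have t: "t > 0" by simp
  have "norm (Beta z (of_real t)) \<le> Beta (Re z) t"
    using integral_norm_bound[of lborel "beta_density z (of_real t)"] z t
    by (simp add: Beta_integral_complex beta_density_integrable)
  moreover have "Gamma (Re z + t) > 0" "Gamma t > 0" "norm (Gamma (z + of_real t)) > 0"
    using z t Gamma_nonzero_right_halfplane[of "z + of_real t"] by auto
  ultimately show ?thesis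
    using z t by (simp add: Beta_def norm_mult norm_divide Gamma_complex_of_real field_simps)
qed (use z in simp)

section \<open>The integral operator on monomials\<close>

text \<open>Apart from the constant that comes from the principal branch, the integrand of the fractional
  integral of the monomial \<open>t powr e\<close>; \<open>b\<close> is the order minus \<open>\<sigma>\<close>.\<close>

definition frac_kernel :: "real \<Rightarrow> complex \<Rightarrow> real \<Rightarrow> complex \<Rightarrow> real \<Rightarrow> complex" where
  "frac_kernel \<eta> b y e t =
     of_real (t powr (\<eta> - 1)) * of_real t powr e * of_real (y powr \<eta> - t powr \<eta>) powr (b - 1)"

lemma frac_kernel_measurable [measurable]: "frac_kernel \<eta> b y e \<in> borel_measurable borel"
  unfolding frac_kernel_def by measurable

context
  fixes \<eta> y :: real
  assumes \<eta>: "\<eta> > 0" and y: "y > 0"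
begin

lemma frac_kernel_norm:
  assumes "0 < t" "t < y"
  shows "norm (frac_kernel \<eta> b y e t) =
           t powr (\<eta> - 1) * t powr Re e * (y powr \<eta> - t powr \<eta>) powr (Re b - 1)"
proof -
  have "t powr \<eta> < y powr \<eta>"
    using assms \<eta> by (intro powr_less_mono2) auto
  then show ?thesis
    using assms norm_powr_of_real[of t e] norm_powr_of_real[of "y powr \<eta> - t powr \<eta>" "b - 1"]
    by (simp add: frac_kernel_def norm_mult del: of_real_diff)
qed

lemma frac_kernel_real_substitution:
  fixes r s u :: real
  assumes u: "0 < u" "u < 1"
  defines "t \<equiv> y * u powr (1 / \<eta>)"
  shows "t powr (\<eta> - 1) * t powr r * (y powr \<eta> - t powr \<eta>) powr (s - 1) * (y / \<eta> * u powr (1 / \<eta> - 1)) =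
           y powr (r + \<eta> * s) / \<eta> * (u powr (r / \<eta>) * (1 - u) powr (s - 1))"
proof -
  have t\<eta>: "y powr \<eta> - t powr \<eta> = y powr \<eta> * (1 - u)"
    using u y \<eta> by (simp add: t_def powr_mult powr_powr algebra_simps)
  have "t powr (\<eta> - 1) * t powr r = t powr (\<eta> - 1 + r)"
    by (simp add: powr_add)
  also have "\<dots> = y powr (\<eta> - 1 + r) * u powr ((1 / \<eta>) * (\<eta> - 1 + r))"
    using u y by (simp add: t_def powr_mult powr_powr)
  finally have "t powr (\<eta> - 1) * t powr r * (y powr \<eta> - t powr \<eta>) powr (s - 1) * (y / \<eta> * u powr (1 / \<eta> - 1)) =
     (y powr (\<eta> - 1 + r) * y powr (\<eta> * (s - 1)) * y powr 1) / \<eta> *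
     (u powr ((1 / \<eta>) * (\<eta> - 1 + r)) * u powr (1 / \<eta> - 1)) * (1 - u) powr (s - 1)"
    unfolding t\<eta> using y u by (simp add: powr_mult powr_powr)
  also have "y powr (\<eta> - 1 + r) * y powr (\<eta> * (s - 1)) * y powr 1 = y powr (r + \<eta> * s)"
  proof -
    have "\<eta> - 1 + r + \<eta> * (s - 1) + 1 = r + \<eta> * s"
      by (simp add: algebra_simps)
    then show ?thesis
      by (simp only: powr_add [symmetric])
  qed
  also have "u powr ((1 / \<eta>) * (\<eta> - 1 + r)) * u powr (1 / \<eta> - 1) = u powr (r / \<eta>)"
  proof -
    have "(1 / \<eta>) * (\<eta> - 1 + r) + (1 / \<eta> - 1) = r / \<eta>"
      using \<eta> by (simp add: field_simps)
    then show ?thesis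
      by (simp only: powr_add [symmetric])
  qed
  finally show ?thesis by (simp only: times_divide_eq_left times_divide_eq_right mult.assoc)
qed

lemma frac_kernel_substitution:
  fixes u :: real
  assumes u: "0 < u" "u < 1"
  defines "t \<equiv> y * u powr (1 / \<eta>)"
  shows "(y / \<eta> * u powr (1 / \<eta> - 1)) *\<^sub>R frac_kernel \<eta> b y e t =
           of_real y powr (e + of_real \<eta> * b) / of_real \<eta> * beta_density (e / of_real \<eta> + 1) b u"
proof -
  define Y where "Y = complex_of_real y"
  have t: "t > 0" using y u by (simp add: t_def)
  have ofr: "complex_of_real (v powr c) = of_real v powr of_real c" if "v > 0" for v c :: real
    using that by (simp add: powr_of_real)
  have t\<eta>: "y powr \<eta> - t powr \<eta> = y powr \<eta> * (1 - u)"
    using u y \<eta> by (simp add: t_def powr_mult powr_powr algebra_simps)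
  have A: "complex_of_real (y powr \<eta> - t powr \<eta>) powr (b - 1) =
          of_real y powr (of_real \<eta> * (b - 1)) * of_real (1 - u) powr (b - 1)"
    unfolding t\<eta> using u y powr_of_real_mult[of "y powr \<eta>" "1 - u" "b - 1"]
    by (simp add: ofr powr_powr powr_def Ln_of_real algebra_simps exp_of_real ln_powr del: of_real_diff)
  have T: "complex_of_real t powr c = of_real y powr c * of_real u powr (c / of_real \<eta>)" for c
    unfolding t_def using u y powr_of_real_mult[of y "u powr (1 / \<eta>)" c]
    by (simp add: powr_def Ln_of_real ln_powr)
  have "(y / \<eta> * u powr (1 / \<eta> - 1)) *\<^sub>R frac_kernel \<eta> b y e t =
      (of_real y powr of_real (\<eta> - 1) * of_real y powr e * of_real y powr (of_real \<eta> * (b - 1)) * of_real y powr 1) / of_real \<eta> *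
      (of_real u powr (of_real (\<eta> - 1) / of_real \<eta>) * of_real u powr (e / of_real \<eta>) * of_real u powr of_real (1 / \<eta> - 1)) *
      of_real (1 - u) powr (b - 1)"
    unfolding frac_kernel_def A using y u t
    by (simp add: ofr T scaleR_conv_of_real del: of_real_diff)
  also have "of_real y powr of_real (\<eta> - 1) * of_real y powr e * of_real y powr (of_real \<eta> * (b - 1)) * of_real y powr 1
        = complex_of_real y powr (e + of_real \<eta> * b)"
    using y by (simp only: powr_add [symmetric]) (simp add: algebra_simps)
  also have "of_real u powr (of_real (\<eta> - 1) / of_real \<eta>) * of_real u powr (e / of_real \<eta>) * of_real u powr of_real (1 / \<eta> - 1)
       = complex_of_real u powr (e / of_real \<eta>)"
    using u \<eta> by (simp only: powr_add [symmetric]) (simp add: field_simps)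
  finally show ?thesis
    using u by (simp add: beta_density_def)
qed

lemma frac_substitution_limits:
  "((ereal \<circ> (\<lambda>u. y * u powr (1 / \<eta>)) \<circ> real_of_ereal) \<longlongrightarrow> ereal 0) (at_right 0)"
  "((ereal \<circ> (\<lambda>u. y * u powr (1 / \<eta>)) \<circ> real_of_ereal) \<longlongrightarrow> ereal y) (at_left 1)"
proof -
  have "((\<lambda>u. y * u powr (1 / \<eta>)) \<longlongrightarrow> y * 0 powr (1 / \<eta>)) (at_right 0)"
    using \<eta> by (intro tendsto_intros tendsto_powr2) (auto simp: eventually_at_right_less eventually_at_filter)
  then show "((ereal \<circ> (\<lambda>u. y * u powr (1 / \<eta>)) \<circ> real_of_ereal) \<longlongrightarrow> ereal 0) (at_right 0)"
    unfolding zero_ereal_def by (subst ereal_tendsto_simps1) (use \<eta> in \<open>auto simp: o_def\<close>)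
  have "((\<lambda>u. y * u powr (1 / \<eta>)) \<longlongrightarrow> y * 1 powr (1 / \<eta>)) (at_left 1)"
    by (intro tendsto_intros) auto
  then show "((ereal \<circ> (\<lambda>u. y * u powr (1 / \<eta>)) \<circ> real_of_ereal) \<longlongrightarrow> ereal y) (at_left 1)"
    unfolding one_ereal_def by (subst ereal_tendsto_simps1) (auto simp: o_def)
qed

lemma frac_substitution_deriv:
  assumes "0 < u"
  shows "((\<lambda>u. y * u powr (1 / \<eta>)) has_real_derivative y / \<eta> * u powr (1 / \<eta> - 1)) (at u)"
  using assms by (auto intro!: derivative_eq_intros simp: powr_diff)

lemma frac_substitution_range:
  fixes u :: real
  assumes "0 < u" "u < 1"
  shows "0 < y * u powr (1 / \<eta>)" "y * u powr (1 / \<eta>) < y"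
proof -
  have "u powr (1 / \<eta>) < 1 powr (1 / \<eta>)"
    using assms \<eta> by (intro powr_less_mono2) auto
  then show "0 < y * u powr (1 / \<eta>)" "y * u powr (1 / \<eta>) < y"
    using assms y by auto
qed

text \<open>The substitution \<open>t = y * u powr (1 / \<eta>)\<close> turns the kernel into the Beta density. Integrability is
  settled first on absolute values: for nonnegative functions the substitution rule transports it from
  the Beta density to the kernel.\<close>

lemma frac_kernel_integrals:
  assumes e: "Re e > - \<eta>" and b: "Re b > 0"
  shows "set_integrable lborel {0<..<y} (frac_kernel \<eta> b y e)"
    and "(LINT t:{0<..<y}|lborel. frac_kernel \<eta> b y e t) =
           of_real y powr (e + of_real \<eta> * b) / of_real \<eta> * Beta (e / of_real \<eta> + 1) b"
proof -
  let ?g = "\<lambda>u. y * u powr (1 / \<eta>)" and ?g' = "\<lambda>u. y / \<eta> * u powr (1 / \<eta> - 1)"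
  let ?R = "\<lambda>t. t powr (\<eta> - 1) * t powr Re e * (y powr \<eta> - t powr \<eta>) powr (Re b - 1)"
  let ?p = "e / of_real \<eta> + 1"
  have p: "Re ?p > 0" using e \<eta> by (simp add: field_simps)
  have ein: "einterval 0 1 = {0<..<1::real}" "einterval (ereal 0) (ereal y) = {0<..<y}"
    by (auto simp: einterval_def zero_ereal_def one_ereal_def)
  have less: "?g u powr \<eta> < y powr \<eta>" if "0 < u" "u < 1" for u
    using frac_substitution_range[OF that] \<eta> by (intro powr_less_mono2) auto
  have contR: "isCont ?R (?g u)" if "0 < ereal u" "ereal u < 1" for u
    using frac_substitution_range[of u] less[of u] that
    by (intro continuous_intros) (auto simp: zero_ereal_def one_ereal_def)
  have contK: "isCont (frac_kernel \<eta> b y e) (?g u)" if "0 < ereal u" "ereal u < 1" for u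
    unfolding frac_kernel_def [abs_def]
    using frac_substitution_range[of u] less[of u] that
    by (intro continuous_intros)
       (auto simp: zero_ereal_def one_ereal_def complex_nonpos_Reals_iff)
  have contg': "isCont ?g' u" if "0 < ereal u" "ereal u < 1" for u
    using that by (intro continuous_intros) (auto simp: zero_ereal_def)
  have g'0: "0 \<le> ?g' u" for u
    using \<eta> y by simp
  have der: "((\<lambda>u. y * u powr (1 / \<eta>)) has_real_derivative y / \<eta> * u powr (1 / \<eta> - 1)) (at u)" if "0 < ereal u" for u
    using that by (intro frac_substitution_deriv) (auto simp: zero_ereal_def)
  have Rg: "indicator {0<..<1} u *\<^sub>R (?R (?g u) * ?g' u) =
       y powr (Re e + \<eta> * Re b) / \<eta> * norm (beta_density ?p b u)" for u
    using frac_kernel_real_substitution[where u = u and r = "Re e" and s = "Re b"] 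
    by (auto simp: beta_density_norm indicator_def)
  have int1: "set_integrable lborel (einterval 0 1) (\<lambda>u. ?R (?g u) * ?g' u)"
    unfolding set_integrable_def ein Rg
    using beta_density_integrable(1)[OF p b] by simp
  note sub = interval_integral_substitution_nonneg[of 0 1 ?g ?g' ?R "ereal 0" "ereal y",
      OF _ der contR contg' _ g'0 frac_substitution_limits int1]
  have R_norm: "indicator {0<..<y} t *\<^sub>R ?R t = indicator {0<..<y} t *\<^sub>R norm (frac_kernel \<eta> b y e t)" for t
    by (auto simp: indicator_def frac_kernel_norm)
  have R: "set_integrable lborel {0<..<y} (\<lambda>t. norm (frac_kernel \<eta> b y e t))"
    using sub(1) unfolding ein set_integrable_def R_norm by simp
  show K: "set_integrable lborel {0<..<y} (frac_kernel \<eta> b y e)"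
    using R unfolding set_integrable_def
    by (subst integrable_norm_iff [symmetric]) (auto simp: abs_mult)
  have Kg: "indicator {0<..<1} u *\<^sub>R (?g' u *\<^sub>R frac_kernel \<eta> b y e (?g u)) =
     of_real y powr (e + of_real \<eta> * b) / of_real \<eta> * beta_density ?p b u" for u
    using frac_kernel_substitution[where u = u and b = b and e = e] by (auto simp: indicator_def beta_density_def)
  have "(LINT t:{0<..<y}|lborel. frac_kernel \<eta> b y e t) = (LBINT t=ereal 0..ereal y. frac_kernel \<eta> b y e t)"
    using y unfolding interval_lebesgue_integral_def ein by simp
  also have "\<dots> = (LBINT u=0..1. ?g' u *\<^sub>R frac_kernel \<eta> b y e (?g u))"
  proof (rule interval_integral_substitution_integrable[of 0 1 ?g ?g', OF _ der contK contg' g'0 frac_substitution_limits])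
    show "set_integrable lborel (einterval 0 1) (\<lambda>u. ?g' u *\<^sub>R frac_kernel \<eta> b y e (?g u))"
      unfolding set_integrable_def ein Kg using beta_density_integrable(1)[OF p b] by simp
    show "set_integrable lborel (einterval (ereal 0) (ereal y)) (frac_kernel \<eta> b y e)"
      unfolding ein by (rule K)
  qed auto
  also have "\<dots> = (\<integral>u. of_real y powr (e + of_real \<eta> * b) / of_real \<eta> * beta_density ?p b u \<partial>lborel)"
    unfolding interval_lebesgue_integral_def set_lebesgue_integral_def ein Kg by simp
  finally show "(LINT t:{0<..<y}|lborel. frac_kernel \<eta> b y e t) =
           of_real y powr (e + of_real \<eta> * b) / of_real \<eta> * Beta (e / of_real \<eta> + 1) b"
    using Beta_integral_complex[OF p b] by simp
qed

end

section \<open>Abel's limit theorem\<close>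

text \<open>Summation by parts expresses the difference as \<open>(1 - r) * (\<Sum>n. c n * r ^ n)\<close> with the null sequence
  \<open>c\<close> of errors of the partial sums: finitely many terms are killed by the factor \<open>1 - r\<close>, the
  others are small against \<open>(1 - r) * (\<Sum>n. r ^ n) = 1\<close>.\<close>

lemma Abel_limit:
  fixes a :: "nat \<Rightarrow> complex"
  assumes a: "summable a"
  shows "((\<lambda>r. \<Sum>n. a n * of_real r ^ n) \<longlongrightarrow> suminf a) (at_left 1)"
proof -
  define c where "c n = (\<Sum>i\<le>n. a i) - suminf a" for n
  have c: "c \<longlonglongrightarrow> 0"
    using tendsto_diff[OF summable_LIMSEQ'[OF a] tendsto_const[of "suminf a"]] by (simp add: c_def [abs_def])
  then obtain K where K: "\<And>n. norm (c n) \<le> K" "K > 0"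
    using convergent_imp_Bseq[of c] by (auto simp: convergent_def Bseq_def)
  have sums_c: "(\<lambda>n. (1 - of_real r) * (c n * of_real r ^ n)) sums ((\<Sum>n. a n * of_real r ^ n) - suminf a)"
    if r: "0 < r" "r < 1" for r :: real
  proof -
    let ?z = "complex_of_real r"
    have z: "norm ?z < 1" using r by simp
    have sa: "summable (\<lambda>n. norm (a n * ?z ^ n))"
      using powser_insidea[of a 1 ?z] a z by simp
    have sg: "summable (\<lambda>n. norm (?z ^ n))"
      using summable_geometric[of r] r by (simp add: norm_power)
    have "(\<lambda>n. \<Sum>i\<le>n. (a i * ?z ^ i) * ?z ^ (n - i)) sums ((\<Sum>n. a n * ?z ^ n) * (\<Sum>n. ?z ^ n))"
      by (rule Cauchy_product_sums[OF sa sg])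
    also have "(\<lambda>n. \<Sum>i\<le>n. (a i * ?z ^ i) * ?z ^ (n - i)) = (\<lambda>n. (\<Sum>i\<le>n. a i) * ?z ^ n)"
      by (rule ext) (auto simp: sum_distrib_right mult.assoc simp flip: power_add intro!: sum.cong)
    finally have "(\<lambda>n. (\<Sum>i\<le>n. a i) * ?z ^ n - suminf a * ?z ^ n) sums
        ((\<Sum>n. a n * ?z ^ n) * (\<Sum>n. ?z ^ n) - suminf a * (\<Sum>n. ?z ^ n))"
      using summable_norm_cancel[OF sg] by (intro sums_diff sums_mult) (auto intro: summable_sums)
    from sums_mult[OF this, of "1 - ?z"] show ?thesis
    proof (rule back_subst[where P = "\<lambda>f. f sums _", OF back_subst[where P = "\<lambda>S. _ sums S"]])
      have "1 - ?z \<noteq> 0" using r by simp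
      then show "(1 - ?z) * ((\<Sum>n. a n * ?z ^ n) * (\<Sum>n. ?z ^ n) - suminf a * (\<Sum>n. ?z ^ n)) =
          (\<Sum>n. a n * ?z ^ n) - suminf a"
        using z by (simp add: suminf_geometric diff_divide_distrib [symmetric])
    qed (simp add: c_def left_diff_distrib)
  qed
  show ?thesis
  proof (rule tendstoI)
    fix \<epsilon> :: real assume \<epsilon>: "\<epsilon> > 0"
    obtain N where N: "\<And>n. n \<ge> N \<Longrightarrow> norm (c n) < \<epsilon> / 2"
      using c \<epsilon> unfolding LIMSEQ_def by (metis dist_0_norm dist_commute half_gt_zero)
    have "((\<lambda>r. (1 - r) * (real N * K)) \<longlongrightarrow> (1 - 1) * (real N * K)) (at_left 1)"
      by (intro tendsto_intros)
    then have "\<forall>\<^sub>F r in at_left 1. (1 - r) * (real N * K) < \<epsilon> / 2"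
      using \<epsilon> by (intro order_tendstoD(2)) auto
    moreover have "\<forall>\<^sub>F r in at_left (1::real). r \<in> {0<..<1}"
      by (rule eventually_at_leftI[of 0]) auto
    ultimately show "\<forall>\<^sub>F r in at_left 1. dist (\<Sum>n. a n * of_real r ^ n) (suminf a) < \<epsilon>"
    proof eventually_elim
      case (elim r)
      then have r: "0 < r" "r < 1" by auto
      define d where "d n = (if n < N then K else 0)" for n
      have dsum: "(\<lambda>n. (1 - r) * (d n)) sums ((1 - r) * (real N * K))"
        using sums_If_finite_set[of "{..<N}" "\<lambda>_. K"]
        by (intro sums_mult) (simp add: d_def [abs_def])
      have gsum: "(\<lambda>n. (1 - r) * (\<epsilon> / 2 * r ^ n)) sums ((1 - r) * (\<epsilon> / 2 * (1 / (1 - r))))"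
        using r by (intro sums_mult geometric_sums) auto
      have bound: "norm ((1 - of_real r) * (c n * of_real r ^ n)) \<le> (1 - r) * d n + (1 - r) * (\<epsilon> / 2 * r ^ n)" for n
      proof -
        have "norm (c n) * r ^ n \<le> d n + \<epsilon> / 2 * r ^ n"
        proof (cases "n < N")
          case True
          have "norm (c n) * r ^ n \<le> K * 1"
            using K r by (intro mult_mono power_le_one) auto
          moreover have "0 \<le> \<epsilon> / 2 * r ^ n" using \<epsilon> r by simp
          ultimately show ?thesis using True by (simp add: d_def)
        next
          case False
          then show ?thesis
            using N[of n] r by (simp add: d_def mult_right_mono)
        qed
        from mult_left_mono[OF this, of "1 - r"] have "(1 - r) * (norm (c n) * r ^ n) \<le> (1 - r) * d n + (1 - r) * (\<epsilon> / 2 * r ^ n)"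
          using r by (simp add: ring_distribs)
        moreover have "norm (1 - complex_of_real r) = 1 - r"
          using r by (metis abs_of_pos diff_gt_0_iff_gt norm_of_real of_real_1 of_real_diff)
        ultimately show ?thesis
          using r by (simp add: norm_mult norm_power)
      qed
      have "norm ((\<Sum>n. a n * of_real r ^ n) - suminf a) \<le> (1 - r) * (real N * K) + (1 - r) * (\<epsilon> / 2 * (1 / (1 - r)))"
        by (rule norm_sums_le[OF sums_c[OF r] sums_add[OF dsum gsum] bound])
      also have "\<dots> < \<epsilon>"
      proof -
        have "(1 - r) * (\<epsilon> / 2 * (1 / (1 - r))) = \<epsilon> / 2" using r by (simp add: divide_simps)
        then show ?thesis using elim by linarith
      qed
      finally show ?case by (simp add: dist_norm)
    qed
  qed
qed

section \<open>Entire series of real powers\<close>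

definition entire_coeffs :: "(nat \<Rightarrow> complex) \<Rightarrow> bool" where
  "entire_coeffs a \<longleftrightarrow> (\<forall>X. summable (\<lambda>n. a n * X ^ n))"

lemma entire_coeffs_norm_summable:
  assumes "entire_coeffs a"
  shows "summable (\<lambda>n. norm (a n) * r ^ n)"
proof -
  have "summable (\<lambda>n. norm (a n * of_real \<bar>r\<bar> ^ n))"
    using assms by (intro powser_insidea[of a "of_real (\<bar>r\<bar> + 1)"])
      (auto simp: entire_coeffs_def simp del: of_real_add)
  then show ?thesis
    by (intro summable_norm_cancel[of "\<lambda>n. norm (a n) * r ^ n"]) (simp add: norm_mult norm_power abs_mult power_abs)
qed

lemma entire_coeffs_bounded:
  fixes a b :: "nat \<Rightarrow> complex"
  assumes "entire_coeffs a" "\<And>n. norm (b n) \<le> C * norm (a n)"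
  shows "entire_coeffs b"
  unfolding entire_coeffs_def
proof
  fix X :: complex
  have "summable (\<lambda>n. C * (norm (a n) * norm X ^ n))"
    by (intro summable_mult entire_coeffs_norm_summable assms)
  then show "summable (\<lambda>n. b n * X ^ n)"
    by (rule summable_comparison_test'[of _ 0])
      (auto simp: norm_mult norm_power mult.assoc[symmetric] intro: mult_right_mono assms)
qed

lemma entire_coeffs_linear:
  assumes a: "entire_coeffs a"
  shows "entire_coeffs (\<lambda>n. (c + d * of_nat n) * a n)"
proof -
  have s: "summable (\<lambda>n. of_nat n * a n * X ^ n)" for X :: complex
  proof -
    have "summable (\<lambda>n. diffs a n * X ^ n)"
      using a by (intro termdiff_converges_all) (auto simp: entire_coeffs_def)
    from sums_summable[OF diffs_equiv[OF this]] have "summable (\<lambda>n. X * (of_nat n * a n * X ^ (n - Suc 0)))"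
      by (rule summable_mult)
    moreover have "(\<lambda>n. X * (of_nat n * a n * X ^ (n - Suc 0))) = (\<lambda>n. of_nat n * a n * X ^ n)"
    proof
      fix n show "X * (of_nat n * a n * X ^ (n - Suc 0)) = of_nat n * a n * X ^ n"
        by (cases n) auto
    qed
    ultimately show ?thesis by simp
  qed
  have "summable (\<lambda>n. c * (a n * X ^ n) + d * (of_nat n * a n * X ^ n))" for X :: complex
    using a s by (intro summable_add summable_mult) (auto simp: entire_coeffs_def)
  then show "entire_coeffs (\<lambda>n. (c + d * of_nat n) * a n)"
    by (simp add: entire_coeffs_def algebra_simps)
qed

text \<open>The series \<open>\<Sum>n. a n * y powr (e + \<nu> * n)\<close>, written as a power times a power series in \<open>y powr \<nu>\<close> so that
  the theory of power series applies; the weighted derivative, the fractional integral and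
  multiplication by powers all preserve this form.\<close>

definition gen_powser :: "complex \<Rightarrow> real \<Rightarrow> (nat \<Rightarrow> complex) \<Rightarrow> real \<Rightarrow> complex" where
  "gen_powser e \<nu> a y = of_real y powr e * (\<Sum>n. a n * of_real (y powr \<nu>) ^ n)"

lemma gen_powser_has_vector_derivative:
  assumes a: "entire_coeffs a" and y: "y > 0"
  shows "(gen_powser e \<nu> a has_vector_derivative gen_powser (e - 1) \<nu> (\<lambda>n. (e + of_real \<nu> * of_nat n) * a n) y) (at y)"
proof -
  define X where "X = complex_of_real (y powr \<nu>)"
  define F where "F = (\<lambda>z. \<Sum>n. a n * z ^ n)"
  have sX: "summable (\<lambda>n. a n * z ^ n)" for z
    using a by (simp add: entire_coeffs_def)
  have DF: "(F has_field_derivative (\<Sum>n. diffs a n * X ^ n)) (at X)"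
    unfolding F_def by (rule termdiffs_strong_converges_everywhere[OF sX])
  have "((\<lambda>y. complex_of_real (y powr \<nu>)) has_vector_derivative of_real (\<nu> * y powr (\<nu> - 1))) (at y)"
    using y by (intro has_vector_derivative_of_real)
      (auto intro!: derivative_eq_intros simp: has_real_derivative_iff_has_vector_derivative[symmetric])
  from field_vector_diff_chain_at[OF this DF[unfolded X_def]]
  have D2: "((\<lambda>y. F (of_real (y powr \<nu>))) has_vector_derivative
      of_real (\<nu> * y powr (\<nu> - 1)) * (\<Sum>n. diffs a n * X ^ n)) (at y)"
    by (simp add: o_def X_def)
  have "((\<lambda>z. z powr e) has_field_derivative e * of_real y powr (e - 1)) (at (complex_of_real y))"
    using y by (intro has_field_derivative_powr) (auto simp: complex_nonpos_Reals_iff)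
  then have D1: "((\<lambda>y. complex_of_real y powr e) has_vector_derivative e * of_real y powr (e - 1)) (at y)"
    by (rule has_vector_derivative_real_field)
  have "(gen_powser e \<nu> a has_vector_derivative
      (of_real y powr e * (of_real (\<nu> * y powr (\<nu> - 1)) * (\<Sum>n. diffs a n * X ^ n))
       + e * of_real y powr (e - 1) * F X)) (at y)"
    using has_vector_derivative_mult[OF D1 D2] unfolding gen_powser_def [abs_def] F_def X_def by simp
  also have "of_real y powr e * (of_real (\<nu> * y powr (\<nu> - 1)) * (\<Sum>n. diffs a n * X ^ n))
       + e * of_real y powr (e - 1) * F X =
     of_real y powr (e - 1) * (e * F X + of_real \<nu> * (X * (\<Sum>n. diffs a n * X ^ n)))"
    using y by (simp add: X_def powr_diff algebra_simps)
  also have "e * F X + of_real \<nu> * (X * (\<Sum>n. diffs a n * X ^ n)) = (\<Sum>n. (e + of_real \<nu> * of_nat n) * a n * X ^ n)"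
  proof -
    have "(\<lambda>n. of_nat n * a n * X ^ (n - Suc 0)) sums (\<Sum>n. diffs a n * X ^ n)"
      by (intro diffs_equiv termdiff_converges_all sX)
    then have "(\<lambda>n. e * (a n * X ^ n) + of_real \<nu> * (X * (of_nat n * a n * X ^ (n - Suc 0)))) sums
        (e * F X + of_real \<nu> * (X * (\<Sum>n. diffs a n * X ^ n)))"
      unfolding F_def by (intro sums_add sums_mult summable_sums sX)
    moreover have "(\<lambda>n. e * (a n * X ^ n) + of_real \<nu> * (X * (of_nat n * a n * X ^ (n - Suc 0)))) =
        (\<lambda>n. (e + of_real \<nu> * of_nat n) * a n * X ^ n)"
    proof
      fix n show "e * (a n * X ^ n) + of_real \<nu> * (X * (of_nat n * a n * X ^ (n - Suc 0))) =
          (e + of_real \<nu> * of_nat n) * a n * X ^ n"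
        by (cases n) (auto simp: algebra_simps)
    qed
    ultimately show ?thesis by (simp add: sums_iff)
  qed
  finally show ?thesis
    by (simp add: gen_powser_def [abs_def] X_def)
qed

lemma gen_powser_mult: "c * gen_powser e \<nu> a y = gen_powser e \<nu> (\<lambda>n. c * a n) y" if "entire_coeffs a"
proof -
  have "summable (\<lambda>n. a n * of_real (y powr \<nu>) ^ n)"
    using that by (simp add: entire_coeffs_def)
  from suminf_mult[OF this, of c] show ?thesis
    by (simp add: gen_powser_def algebra_simps)
qed

lemma entire_coeffs_mult: "entire_coeffs a \<Longrightarrow> entire_coeffs (\<lambda>n. c * a n)"
  by (rule entire_coeffs_bounded[of a _ "norm c"]) (auto simp: norm_mult)

lemma gen_powser_continuous_on:
  assumes "entire_coeffs a"
  shows "continuous_on {0<..} (gen_powser e \<nu> a)"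
  using gen_powser_has_vector_derivative[OF assms]
  by (intro continuous_at_imp_continuous_on ballI has_vector_derivative_continuous) auto

text \<open>The weighted derivative sends \<open>y powr p\<close> to \<open>- p * y powr (p - \<eta>)\<close>, so it shifts every exponent by
  \<open>- \<eta>\<close>. The representation is only assumed for positive arguments because the fractional integral is
  known only there; derivatives at a positive point do not see the rest.\<close>

lemma weighted_deriv_gen_powser:
  assumes a: "entire_coeffs a" and g: "\<And>y. y > 0 \<Longrightarrow> g y = gen_powser e \<nu> a y" and y: "y > 0"
  shows "weighted_deriv \<eta> g y = gen_powser (e - of_real \<eta>) \<nu> (\<lambda>n. - (e + of_real \<nu> * of_nat n) * a n) y"
proof -
  have "(g has_vector_derivative gen_powser (e - 1) \<nu> (\<lambda>n. (e + of_real \<nu> * of_nat n) * a n) y) (at y)"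
    using gen_powser_has_vector_derivative[OF a y]
    by (rule has_vector_derivative_transform_within_open[of _ _ _ "{0<..}"]) (use g y in auto)
  then have "weighted_deriv \<eta> g y =
      (- 1) * (of_real (y powr (1 - \<eta>)) * gen_powser (e - 1) \<nu> (\<lambda>n. (e + of_real \<nu> * of_nat n) * a n) y)"
    by (simp add: weighted_deriv_def vector_derivative_at)
  also have "of_real (y powr (1 - \<eta>)) * gen_powser (e - 1) \<nu> (\<lambda>n. (e + of_real \<nu> * of_nat n) * a n) y =
      gen_powser (e - of_real \<eta>) \<nu> (\<lambda>n. (e + of_real \<nu> * of_nat n) * a n) y"
  proof -
    have "complex_of_real (y powr (1 - \<eta>)) * of_real y powr (e - 1) = of_real y powr (e - of_real \<eta>)"
      using y by (simp add: powr_of_real [symmetric] powr_add [symmetric])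
    then show ?thesis by (simp add: gen_powser_def)
  qed
  finally show ?thesis
    using gen_powser_mult[OF entire_coeffs_linear[OF a, of e "of_real \<nu>"], of "- 1" "e - of_real \<eta>" \<nu> y]
    by (simp only: mult_minus1 minus_mult_left)
qed

lemma weighted_deriv_iterate_gen_powser:
  assumes a: "entire_coeffs a" and g: "\<And>y. y > 0 \<Longrightarrow> g y = gen_powser e \<nu> a y" and y: "y > 0"
  shows "(weighted_deriv \<eta> ^^ N) g y =
     gen_powser (e - of_nat N * of_real \<eta>) \<nu>
       (\<lambda>n. (\<Prod>j<N. - (e - of_nat j * of_real \<eta> + of_real \<nu> * of_nat n)) * a n) y"
    and "entire_coeffs (\<lambda>n. (\<Prod>j<N. - (e - of_nat j * of_real \<eta> + of_real \<nu> * of_nat n)) * a n)"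
proof -
  let ?c = "\<lambda>N n. (\<Prod>j<N. - (e - of_nat j * of_real \<eta> + of_real \<nu> * of_nat n)) * a n"
  have "(\<forall>y>0. (weighted_deriv \<eta> ^^ N) g y = gen_powser (e - of_nat N * of_real \<eta>) \<nu> (?c N) y) \<and> entire_coeffs (?c N)"
  proof (induction N)
    case (Suc N)
    have c: "?c (Suc N) = (\<lambda>n. - (e - of_nat N * of_real \<eta> + of_real \<nu> * of_nat n) * ?c N n)"
      by (simp add: fun_eq_iff algebra_simps)
    have e: "e - of_nat (Suc N) * of_real \<eta> = e - of_nat N * of_real \<eta> - of_real \<eta>"
      by (simp add: algebra_simps)
    have "entire_coeffs (?c (Suc N))"
      unfolding c using entire_coeffs_linear[of "?c N" "- (e - of_nat N * of_real \<eta>)" "- of_real \<nu>"] Suc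
      by (simp add: algebra_simps)
    moreover have "(weighted_deriv \<eta> ^^ Suc N) g y = gen_powser (e - of_nat (Suc N) * of_real \<eta>) \<nu> (?c (Suc N)) y"
      if "y > 0" for y
      unfolding c e using weighted_deriv_gen_powser[of "?c N" "(weighted_deriv \<eta> ^^ N) g"] Suc that by simp
    ultimately show ?case by blast
  qed (use a g in simp)
  then show "(weighted_deriv \<eta> ^^ N) g y = gen_powser (e - of_nat N * of_real \<eta>) \<nu> (?c N) y" "entire_coeffs (?c N)"
    using y by blast+
qed

section \<open>The fractional derivative of an entire series\<close>

lemma frac_order_bounds:
  assumes "Re \<sigma> > 0"
  shows "0 < Re (of_nat (frac_order \<sigma>) - \<sigma>)"
proof -
  have "real (frac_order \<sigma>) = of_int \<lfloor>Re \<sigma>\<rfloor> + 1"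
    using assms by (simp add: frac_order_def)
  then show ?thesis
    using floor_correct[of "Re \<sigma>"] by simp
qed

lemma powr_of_real_power:
  assumes "t > 0"
  shows "complex_of_real t powr (e + of_real \<nu> * of_nat n) = of_real t powr e * of_real (t powr \<nu>) ^ n"
  using assms by (simp add: powr_def exp_add exp_of_nat_mult [symmetric] exp_of_real [symmetric] Ln_of_real algebra_simps)

lemma frac_kernel_shift:
  assumes "t > 0"
  shows "frac_kernel \<eta> b y (e + of_real \<nu> * of_nat n) t = frac_kernel \<eta> b y e t * of_real (t powr \<nu>) ^ n"
  using powr_of_real_power[OF assms] by (simp add: frac_kernel_def)

text \<open>For \<open>t < y\<close> the base \<open>t powr \<eta> - y powr \<eta>\<close> is negative; splitting off \<open>-1\<close> on the principal branch
  produces the constant \<open>(-1) powr (b - 1)\<close>.\<close>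

lemma frac_integrand_gen_powser:
  fixes \<sigma> :: complex
  assumes \<eta>: "\<eta> > 0" and t: "0 < t" "t < y" and a: "entire_coeffs a" and f: "f t = gen_powser e \<nu> a t"
  defines "b \<equiv> of_nat (frac_order \<sigma>) - \<sigma>"
  shows "frac_integrand \<eta> \<sigma> f y t =
           (- 1) powr (b - 1) * (\<Sum>n. a n * frac_kernel \<eta> b y (e + of_real \<nu> * of_nat n) t)"
    and "norm (a n * frac_kernel \<eta> b y (e + of_real \<nu> * of_nat n) t) =
           norm (a n) * (t powr \<nu>) ^ n * norm (frac_kernel \<eta> b y e t)"
    and "summable (\<lambda>n. norm (a n * frac_kernel \<eta> b y (e + of_real \<nu> * of_nat n) t))"
proof -
  let ?A = "y powr \<eta> - t powr \<eta>"
  have A: "?A > 0"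
    using t \<eta> powr_less_mono2[of \<eta> t y] by simp
  have neg: "complex_of_real (t powr \<eta> - y powr \<eta>) = of_real ?A * (- 1)"
    by simp
  have "complex_of_real (t powr \<eta> - y powr \<eta>) powr (b - 1) = of_real ?A powr (b - 1) * (- 1) powr (b - 1)"
    unfolding neg by (rule powr_times_real_left) (use A in auto)
  moreover have "x / z powr (\<sigma> - of_nat (frac_order \<sigma>) + 1) = x * z powr (b - 1)" for x z :: complex
  proof -
    have "b - 1 = - (\<sigma> - of_nat (frac_order \<sigma>) + 1)" by (simp add: b_def)
    then show ?thesis by (simp only: powr_minus divide_inverse)
  qed
  ultimately have "frac_integrand \<eta> \<sigma> f y t =
     (- 1) powr (b - 1) * (of_real (t powr (\<eta> - 1)) * gen_powser e \<nu> a t * of_real ?A powr (b - 1))"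
    by (simp add: frac_integrand_def f del: of_real_diff)
  also have "of_real (t powr (\<eta> - 1)) * gen_powser e \<nu> a t * of_real ?A powr (b - 1) =
      frac_kernel \<eta> b y e t * (\<Sum>n. a n * of_real (t powr \<nu>) ^ n)"
    by (simp add: gen_powser_def frac_kernel_def del: of_real_diff)
  also have "\<dots> = (\<Sum>n. frac_kernel \<eta> b y e t * (a n * of_real (t powr \<nu>) ^ n))"
    using a by (intro suminf_mult [symmetric]) (auto simp: entire_coeffs_def)
  finally show "frac_integrand \<eta> \<sigma> f y t =
           (- 1) powr (b - 1) * (\<Sum>n. a n * frac_kernel \<eta> b y (e + of_real \<nu> * of_nat n) t)"
    unfolding frac_kernel_shift [OF \<open>0 < t\<close>] by (simp only: mult_ac)
  show *: "norm (a n * frac_kernel \<eta> b y (e + of_real \<nu> * of_nat n) t) =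
           norm (a n) * (t powr \<nu>) ^ n * norm (frac_kernel \<eta> b y e t)" for n
    using t by (simp add: frac_kernel_shift norm_mult norm_power)
  show "summable (\<lambda>n. norm (a n * frac_kernel \<eta> b y (e + of_real \<nu> * of_nat n) t))"
    unfolding * by (intro summable_mult2 entire_coeffs_norm_summable a)
qed

text \<open>All terms are dominated by \<open>(y powr \<nu>) ^ n\<close> times the kernel of the first one, which justifies termwise
  integration and, at \<open>y = 1\<close>, shows that the Beta factors are bounded. Reversing the orientation
  turns \<open>(-1) powr (b - 1)\<close> into \<open>(-1) powr b\<close>.\<close>

lemma frac_integral_gen_powser:
  fixes \<sigma> :: complex
  assumes \<eta>: "\<eta> > 0" and \<nu>: "\<nu> > 0" and y: "y > 0" and e: "Re e > - \<eta>" and \<sigma>: "Re \<sigma> > 0"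
    and a: "entire_coeffs a" and f: "\<And>t. 0 < t \<Longrightarrow> f t = gen_powser e \<nu> a t"
  defines "b \<equiv> of_nat (frac_order \<sigma>) - \<sigma>"
  shows "frac_integral \<eta> \<sigma> f y = gen_powser (e + of_real \<eta> * b) \<nu>
     (\<lambda>n. (- 1) powr b / of_real \<eta> * Beta ((e + of_real \<nu> * of_nat n) / of_real \<eta> + 1) b * a n) y"
    and "entire_coeffs
     (\<lambda>n. (- 1) powr b / of_real \<eta> * Beta ((e + of_real \<nu> * of_nat n) / of_real \<eta> + 1) b * a n)"
proof -
  define en where "en n = e + of_real \<nu> * of_nat n" for n
  have b: "Re b > 0" using frac_order_bounds[OF \<sigma>] by (simp add: b_def)
  have en: "Re (en n) > - \<eta>" for n
    using e \<nu> by (simp add: en_def add_pos_nonneg less_le_trans[OF e])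
  let ?k = "\<lambda>y n t. indicator {0<..<y} t *\<^sub>R frac_kernel \<eta> b y (en n) t"
  have int: "integrable lborel (?k y n)" if "y > 0" for y n
    using frac_kernel_integrals(1)[OF \<eta> that en b] by (simp add: set_integrable_def)
  have int_eq: "integral\<^sup>L lborel (?k y n) = of_real y powr (en n + of_real \<eta> * b) / of_real \<eta> * Beta (en n / of_real \<eta> + 1) b"
    if "y > 0" for y n
    using frac_kernel_integrals(2)[OF \<eta> that en b] by (simp add: set_lebesgue_integral_def)
  have int_bound: "(\<integral>t. norm (?k y n t) \<partial>lborel) \<le> (y powr \<nu>) ^ n * (\<integral>t. norm (?k y 0 t) \<partial>lborel)" if "y > 0" for y n
  proof -
    have "(\<integral>t. norm (?k y n t) \<partial>lborel) \<le> (\<integral>t. (y powr \<nu>) ^ n * norm (?k y 0 t) \<partial>lborel)"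
    proof (rule integral_mono)
      fix t
      show "norm (?k y n t) \<le> (y powr \<nu>) ^ n * norm (?k y 0 t)"
      proof (cases "0 < t \<and> t < y")
        case True
        then have "(t powr \<nu>) ^ n \<le> (y powr \<nu>) ^ n"
          using \<nu> by (intro power_mono powr_mono2) auto
        then show ?thesis
          using True frac_kernel_shift[of t \<eta> b y e \<nu> n]
          by (simp add: en_def norm_mult norm_power mult_right_mono mult.commute)
      qed auto
    qed (intro integrable_mult_right integrable_norm int that)+
    then show ?thesis by simp
  qed
  show ent: "entire_coeffs
     (\<lambda>n. (- 1) powr b / of_real \<eta> * Beta ((e + of_real \<nu> * of_nat n) / of_real \<eta> + 1) b * a n)"
  proof (rule entire_coeffs_bounded[OF a])
    fix n
    have "norm (integral\<^sup>L lborel (?k 1 n)) \<le> (\<integral>t. norm (?k 1 0 t) \<partial>lborel)"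
      using integral_norm_bound[of lborel "?k 1 n"] int_bound[of 1 n] by simp
    then have "norm (Beta (en n / of_real \<eta> + 1) b / of_real \<eta>) \<le> (\<integral>t. norm (?k 1 0 t) \<partial>lborel)"
      by (simp only: int_eq zero_less_one) (simp add: norm_divide)
    then have "norm ((- 1) powr b) * norm (Beta (en n / of_real \<eta> + 1) b / of_real \<eta>) * norm (a n) \<le>
        norm ((- 1) powr b) * (\<integral>t. norm (?k 1 0 t) \<partial>lborel) * norm (a n)"
      by (intro mult_right_mono mult_left_mono) auto
    then show "norm ((- 1) powr b / of_real \<eta> * Beta ((e + of_real \<nu> * of_nat n) / of_real \<eta> + 1) b * a n)
       \<le> (norm ((- 1) powr b) * (\<integral>t. norm (?k 1 0 t) \<partial>lborel)) * norm (a n)"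
      by (simp add: en_def norm_mult norm_divide)
  qed
  let ?F = "\<lambda>n t. a n * ?k y n t"
  have sums: "(\<lambda>n. integral\<^sup>L lborel (?F n)) sums (\<integral>t. (\<Sum>n. ?F n t) \<partial>lborel)"
  proof (rule sums_integral)
    show "integrable lborel (?F n)" for n
      using integrable_mult_right[OF int[OF y], where c = "a n"] by simp
    show "AE t in lborel. summable (\<lambda>n. norm (?F n t))"
    proof (rule AE_I2)
      fix t
      show "summable (\<lambda>n. norm (?F n t))"
        using frac_integrand_gen_powser(3)[where f = f and t = t and y = y and \<sigma> = \<sigma>, OF \<eta> _ _ a f [of t]]
        by (cases "0 < t \<and> t < y") (auto simp: en_def b_def)
    qed
    show "summable (\<lambda>n. \<integral>t. norm (?F n t) \<partial>lborel)"
    proof (rule summable_comparison_test'[of _ 0])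
      show "summable (\<lambda>n. norm (a n) * (y powr \<nu>) ^ n * (\<integral>t. norm (?k y 0 t) \<partial>lborel))"
        by (intro summable_mult2 entire_coeffs_norm_summable a)
      have "(\<integral>t. norm (?F n t) \<partial>lborel) = norm (a n) * (\<integral>t. norm (?k y n t) \<partial>lborel)" for n
        unfolding norm_mult by (rule integral_mult_right_zero)
      then show "norm (\<integral>t. norm (?F n t) \<partial>lborel) \<le> norm (a n) * (y powr \<nu>) ^ n * (\<integral>t. norm (?k y 0 t) \<partial>lborel)" for n
        using mult_left_mono[OF int_bound[OF y, of n], of "norm (a n)"] by (simp add: mult.assoc)
    qed
  qed
  have ein: "einterval (ereal 0) (ereal y) = {0<..<y}"
    by (auto simp: einterval_def)
  have "frac_integral \<eta> \<sigma> f y = - (LINT t:{0<..<y}|lborel. frac_integrand \<eta> \<sigma> f y t)"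
    using y by (simp add: frac_integral_def interval_lebesgue_integral_def ein)
  also have "(LINT t:{0<..<y}|lborel. frac_integrand \<eta> \<sigma> f y t) = (\<integral>t. (- 1) powr (b - 1) * (\<Sum>n. ?F n t) \<partial>lborel)"
    unfolding set_lebesgue_integral_def
  proof (rule Bochner_Integration.integral_cong)
    fix t
    show "indicator {0<..<y} t *\<^sub>R frac_integrand \<eta> \<sigma> f y t = (- 1) powr (b - 1) * (\<Sum>n. ?F n t)"
      using frac_integrand_gen_powser(1)[where f = f and t = t and y = y and \<sigma> = \<sigma>, OF \<eta> _ _ a f [of t]]
      by (cases "0 < t \<and> t < y") (auto simp: en_def b_def)
  qed simp
  also have "\<dots> = (- 1) powr (b - 1) * (\<Sum>n. integral\<^sup>L lborel (?F n))"
    using sums by (simp add: sums_iff)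
  also have "\<dots> = (- 1) powr (b - 1) * (\<Sum>n. of_real y powr (e + of_real \<eta> * b) *
      (1 / of_real \<eta> * Beta (en n / of_real \<eta> + 1) b * a n * of_real (y powr \<nu>) ^ n))"
  proof -
    have "integral\<^sup>L lborel (?F n) = of_real y powr (e + of_real \<eta> * b) *
      (1 / of_real \<eta> * Beta (en n / of_real \<eta> + 1) b * a n * of_real (y powr \<nu>) ^ n)" for n
    proof -
      have ex: "en n + of_real \<eta> * b = (e + of_real \<eta> * b) + of_real \<nu> * of_nat n"
        by (simp add: en_def)
      have "integral\<^sup>L lborel (?F n) = a n * integral\<^sup>L lborel (?k y n)"
        by (rule integral_mult_right_zero)
      then show ?thesis
        unfolding int_eq[OF y] ex powr_of_real_power[OF y] by simp
    qed
    then show ?thesis by simp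
  qed
  also have "- ((- 1) powr (b - 1) * (\<Sum>n. of_real y powr (e + of_real \<eta> * b) *
      (1 / of_real \<eta> * Beta (en n / of_real \<eta> + 1) b * a n * of_real (y powr \<nu>) ^ n))) =
      (- 1) powr b * (\<Sum>n. of_real y powr (e + of_real \<eta> * b) *
      (1 / of_real \<eta> * Beta (en n / of_real \<eta> + 1) b * a n * of_real (y powr \<nu>) ^ n))"
    by (simp add: powr_diff)
  also have "\<dots> = (\<Sum>n. of_real y powr (e + of_real \<eta> * b) *
      ((- 1) powr b / of_real \<eta> * Beta (en n / of_real \<eta> + 1) b * a n * of_real (y powr \<nu>) ^ n))"
  proof -
    have "summable (\<lambda>n. (1 / (- 1) powr b) * ((- 1) powr b / of_real \<eta> * Beta (en n / of_real \<eta> + 1) b * a n * of_real (y powr \<nu>) ^ n))"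
      using ent by (intro summable_mult) (auto simp: entire_coeffs_def en_def)
    then have "summable (\<lambda>n. of_real y powr (e + of_real \<eta> * b) * (1 / of_real \<eta> * Beta (en n / of_real \<eta> + 1) b * a n * of_real (y powr \<nu>) ^ n))"
      by (intro summable_mult) (simp add: mult.assoc)
    from suminf_mult[OF this, of "(- 1) powr b"] show ?thesis
      by (simp add: mult_ac)
  qed
  also have "\<dots> = gen_powser (e + of_real \<eta> * b) \<nu>
     (\<lambda>n. (- 1) powr b / of_real \<eta> * Beta ((e + of_real \<nu> * of_nat n) / of_real \<eta> + 1) b * a n) y"
    unfolding gen_powser_def using ent by (subst suminf_mult) (auto simp: entire_coeffs_def en_def)
  finally show "frac_integral \<eta> \<sigma> f y = gen_powser (e + of_real \<eta> * b) \<nu>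
     (\<lambda>n. (- 1) powr b / of_real \<eta> * Beta ((e + of_real \<nu> * of_nat n) / of_real \<eta> + 1) b * a n) y" .
qed

lemma prod_falling_pochhammer:
  fixes z :: complex
  shows "(\<Prod>j<N. z + of_nat N - of_nat (Suc j)) = pochhammer z N"
proof -
  have "pochhammer z N = (\<Prod>j<N. z + of_nat j)"
    by (simp add: pochhammer_prod atLeast0LessThan)
  also have "\<dots> = (\<Prod>j<N. z + of_nat (N - Suc j))"
    by (rule prod.nat_diff_reindex [symmetric])
  also have "\<dots> = (\<Prod>j<N. z + of_nat N - of_nat (Suc j))"
    by (intro prod.cong) (auto simp: of_nat_diff algebra_simps)
  finally show ?thesis ..
qed

text \<open>The \<open>N\<close> derivatives contribute \<open>(-1) ^ N * \<eta> ^ N\<close> and the Pochhammer symbol that lowers the argument of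
  the reciprocal Gamma function in the Beta factor from \<open>p n + 1 + b\<close> to \<open>p n - \<sigma> + 1\<close>. With the
  reciprocal Gamma function this remains true where \<open>\<Gamma>\<close> has poles.\<close>

theorem frac_deriv_gen_powser:
  fixes \<sigma> :: complex
  assumes \<eta>: "\<eta> > 0" and \<nu>: "\<nu> > 0" and x: "x > 0" and e: "Re e > - \<eta>" and \<sigma>: "Re \<sigma> > 0"
    and a: "entire_coeffs a" and f: "\<And>t. 0 < t \<Longrightarrow> f t = gen_powser e \<nu> a t"
  defines "c \<equiv> \<lambda>n. Gamma ((e + of_real \<nu> * of_nat n) / of_real \<eta> + 1) *
                    rGamma ((e + of_real \<nu> * of_nat n) / of_real \<eta> - \<sigma> + 1) * a n"
  shows "frac_deriv \<eta> \<sigma> f x = (- 1) powr (- \<sigma>) * of_real \<eta> powr \<sigma> * gen_powser (e - of_real \<eta> * \<sigma>) \<nu> c x"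
    and "entire_coeffs c"
proof -
  define N where "N = frac_order \<sigma>"
  define b where "b = of_nat N - \<sigma>"
  define p where "p n = (e + of_real \<nu> * of_nat n) / of_real \<eta>" for n
  define d where "d n = (- 1) powr b / of_real \<eta> * Beta ((e + of_real \<nu> * of_nat n) / of_real \<eta> + 1) b * a n" for n
  have b: "Re b > 0" using frac_order_bounds[OF \<sigma>] by (simp add: b_def N_def)
  have d: "entire_coeffs d" and fi: "\<And>y. y > 0 \<Longrightarrow> frac_integral \<eta> \<sigma> f y = gen_powser (e + of_real \<eta> * b) \<nu> d y"
    unfolding d_def [abs_def] b_def N_def
    using frac_integral_gen_powser[OF \<eta> \<nu> _ e \<sigma> a f] x by auto
  let ?P = "\<lambda>n. (\<Prod>j<N. - (e + of_real \<eta> * b - of_nat j * of_real \<eta> + of_real \<nu> * of_nat n)) * d n"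
  note it = weighted_deriv_iterate_gen_powser[OF d fi x, where \<eta> = \<eta> and N = N]
  define C where "C = (- 1) ^ N * of_real \<eta> ^ N * (- 1) powr b / of_real \<eta> * Gamma b"
  have "Gamma b \<noteq> 0" using Gamma_nonzero_right_halfplane[OF b] .
  then have C: "C \<noteq> 0" using \<eta> by (simp add: C_def)
  have P: "?P n = C * c n" for n
  proof -
    have "- (e + of_real \<eta> * b - of_nat j * of_real \<eta> + of_real \<nu> * of_nat n) =
        (- of_real \<eta>) * ((p n - \<sigma> + 1) + of_nat N - of_nat (Suc j))" for j
      using \<eta> by (simp add: p_def b_def field_simps)
    then have "(\<Prod>j<N. - (e + of_real \<eta> * b - of_nat j * of_real \<eta> + of_real \<nu> * of_nat n)) =
        (- of_real \<eta>) ^ N * (\<Prod>j<N. (p n - \<sigma> + 1) + of_nat N - of_nat (Suc j))"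
      by (simp only: prod.distrib prod_constant card_lessThan)
    also have "(\<Prod>j<N. (p n - \<sigma> + 1) + of_nat N - of_nat (Suc j)) = pochhammer (p n - \<sigma> + 1) N"
      by (rule prod_falling_pochhammer)
    finally have 1: "(\<Prod>j<N. - (e + of_real \<eta> * b - of_nat j * of_real \<eta> + of_real \<nu> * of_nat n)) =
        (- 1) ^ N * of_real \<eta> ^ N * pochhammer (p n - \<sigma> + 1) N"
      by (simp add: power_minus [of "of_real \<eta>"])
    have "rGamma (p n - \<sigma> + 1) = pochhammer (p n - \<sigma> + 1) N * rGamma (p n - \<sigma> + 1 + of_nat N)"
      by (rule pochhammer_rGamma)
    also have "p n - \<sigma> + 1 + of_nat N = p n + 1 + b"
      by (simp add: b_def)
    finally have 2: "rGamma (p n - \<sigma> + 1) = pochhammer (p n - \<sigma> + 1) N * rGamma (p n + 1 + b)" .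
    show ?thesis
      unfolding 1 C_def c_def d_def p_def [symmetric] 2
      by (simp add: Beta_def rGamma_inverse_Gamma divide_inverse mult_ac)
  qed
  have ent: "entire_coeffs (\<lambda>n. C * c n)"
    using it(2) unfolding P .
  show c: "entire_coeffs c"
    using entire_coeffs_mult[OF ent, of "1 / C"] C by simp
  have ex: "e + of_real \<eta> * b - of_nat N * of_real \<eta> = e - of_real \<eta> * \<sigma>"
    by (simp add: b_def algebra_simps)
  have "frac_deriv \<eta> \<sigma> f x = of_real \<eta> powr (\<sigma> - of_nat N + 1) / Gamma b * gen_powser (e - of_real \<eta> * \<sigma>) \<nu> (\<lambda>n. C * c n) x"
    using it(1) unfolding frac_deriv_def P ex by (simp add: N_def b_def)
  also have "\<dots> = of_real \<eta> powr (\<sigma> - of_nat N + 1) / Gamma b * C * gen_powser (e - of_real \<eta> * \<sigma>) \<nu> c x"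
    using gen_powser_mult[OF c, of C] by simp
  also have "of_real \<eta> powr (\<sigma> - of_nat N + 1) / Gamma b * C = (- 1) powr (- \<sigma>) * of_real \<eta> powr \<sigma>"
  proof -
    have "(- 1) powr b = (- 1) ^ N * (- 1 :: complex) powr (- \<sigma>)"
      by (simp add: b_def powr_diff powr_minus divide_inverse)
    then have "(- 1) ^ N * (- 1) powr b = (- 1 :: complex) powr (- \<sigma>)"
      by (simp add: mult.assoc [symmetric] power_mult_distrib [symmetric])
    moreover have "complex_of_real \<eta> powr (\<sigma> - of_nat N + 1) * of_real \<eta> ^ N / of_real \<eta> = of_real \<eta> powr \<sigma>"
      using \<eta> by (simp add: powr_add powr_diff)
    moreover have "of_real \<eta> powr (\<sigma> - of_nat N + 1) / Gamma b * C =
        ((- 1) ^ N * (- 1) powr b) * (of_real \<eta> powr (\<sigma> - of_nat N + 1) * of_real \<eta> ^ N / of_real \<eta>) * (Gamma b / Gamma b)"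
      unfolding C_def by (simp only: divide_inverse mult_ac)
    ultimately show ?thesis
      using \<open>Gamma b \<noteq> 0\<close> by simp
  qed
  finally show "frac_deriv \<eta> \<sigma> f x = (- 1) powr (- \<sigma>) * of_real \<eta> powr \<sigma> * gen_powser (e - of_real \<eta> * \<sigma>) \<nu> c x" .
qed

section \<open>Laplace integrals of bounded continuous functions\<close>

text \<open>A gauge integral over a half line is automatically an improper integral, even where it converges only
  conditionally: its definition already compares with large compact intervals.\<close>

lemma improper_integral_tendsto:
  fixes f :: "real \<Rightarrow> complex"
  assumes f: "f integrable_on {0<..}"
  shows "((\<lambda>T. integral {0..T} f) \<longlongrightarrow> integral {0<..} f) at_top"
proof (rule tendstoI)
  fix \<epsilon> :: real assume "\<epsilon> > 0"
  with has_integral_alt'[THEN iffD1, OF integrable_integral[OF f]]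
  obtain B where B: "B > 0" "\<And>a b. ball 0 B \<subseteq> cbox a b \<Longrightarrow>
      norm (integral (cbox a b) (\<lambda>x. if x \<in> {0<..} then f x else 0) - integral {0<..} f) < \<epsilon>"
    by meson
  show "\<forall>\<^sub>F T in at_top. dist (integral {0..T} f) (integral {0<..} f) < \<epsilon>"
    using eventually_ge_at_top[of B]
  proof eventually_elim
    case (elim T)
    have "ball 0 B \<subseteq> cbox (- B) T"
      using elim by (auto simp: dist_real_def)
    from B(2)[OF this] have "norm (integral ({0<..} \<inter> cbox (- B) T) f - integral {0<..} f) < \<epsilon>"
      by (simp only: integral_restrict_Int)
    moreover have "integral ({0<..} \<inter> cbox (- B) T) f = integral {0..T} f"
    proof (rule integral_spike_set)
      show "negligible {x \<in> {0<..} \<inter> cbox (- B) T - {0..T}. f x \<noteq> 0}"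
        by (rule negligible_subset[of "{}"]) auto
      show "negligible {x \<in> {0..T} - {0<..} \<inter> cbox (- B) T. f x \<noteq> 0}"
        by (rule negligible_subset[of "{0}"]) (use B(1) elim in auto)
    qed
    ultimately show ?case by (simp add: dist_norm)
  qed
qed

lemma exp_decay_integrable:
  fixes \<delta> :: real
  assumes "\<delta> > 0"
  shows "integrable lborel (\<lambda>z. indicator {0..} z * exp (- \<delta> * z))"
proof -
  have "(\<lambda>z. exp (- \<delta> * z)) absolutely_integrable_on {0..}"
    using integrable_on_exp_minus_to_infinity[OF assms, of 0]
    by (intro nonnegative_absolutely_integrable_1) auto
  then have "integrable lebesgue (\<lambda>z. indicator {0..} z * exp (- \<delta> * z))"
    by (simp add: set_integrable_def)
  then show ?thesis
    by (subst (asm) integrable_completion) auto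
qed

definition laplace_kernel :: "(real \<Rightarrow> complex) \<Rightarrow> complex \<Rightarrow> real \<Rightarrow> complex" where
  "laplace_kernel \<Phi> p z = indicator {0..} z *\<^sub>R (exp (- p * of_real z) * \<Phi> z)"

context
  fixes \<Phi> :: "real \<Rightarrow> complex" and K :: real
  assumes cont: "continuous_on {0..} \<Phi>" and bound: "\<And>z. z \<ge> 0 \<Longrightarrow> norm (\<Phi> z) \<le> K"
begin

lemma laplace_kernel_measurable [measurable]: "laplace_kernel \<Phi> p \<in> borel_measurable borel"
  unfolding laplace_kernel_def
  by (intro borel_measurable_continuous_on_indicator continuous_intros cont) auto

lemma laplace_kernel_bound:
  assumes "\<delta> \<le> Re p"
  shows "norm (laplace_kernel \<Phi> p z) \<le> K * (indicator {0..} z * exp (- \<delta> * z))"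
proof (cases "z \<ge> 0")
  case True
  have "exp (- (Re p * z)) \<le> exp (- (\<delta> * z))"
    using True assms by (simp add: mult_right_mono)
  from mult_mono[OF this bound[OF True]] True show ?thesis
    by (simp add: laplace_kernel_def norm_mult mult.commute)
qed (simp add: laplace_kernel_def)

lemma laplace_kernel_integrable:
  assumes "Re p > 0"
  shows "integrable lborel (laplace_kernel \<Phi> p)"
proof (rule Bochner_Integration.integrable_bound)
  show "integrable lborel (\<lambda>z. K * (indicator {0..} z * exp (- Re p * z)))"
    using exp_decay_integrable[OF assms] by (rule integrable_mult_right)
  show "AE z in lborel. norm (laplace_kernel \<Phi> p z) \<le> norm (K * (indicator {0..} z * exp (- Re p * z)))"
    unfolding real_norm_def by (intro AE_I2 order_trans[OF laplace_kernel_bound[OF order_refl] abs_ge_self])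
qed simp

lemma laplace_kernel_finite:
  "integral (cbox 0 T) (\<lambda>z. exp (- p * of_real z) * \<Phi> z) = (\<integral>z. indicator {..T} z *\<^sub>R laplace_kernel \<Phi> p z \<partial>lborel)"
proof -
  have c: "continuous_on {0..T} (\<lambda>z. exp (- p * of_real z) * \<Phi> z)"
    by (intro continuous_intros continuous_on_subset[OF cont]) auto
  have "set_integrable lborel {0..T} (\<lambda>z. exp (- p * of_real z) * \<Phi> z)"
    by (rule borel_integrable_compact[OF compact_Icc c, folded set_integrable_def])
  from set_borel_integral_eq_integral(2)[OF this]
  have "integral (cbox 0 T) (\<lambda>z. exp (- p * of_real z) * \<Phi> z) =
      (\<integral>z. indicator {0..T} z *\<^sub>R (exp (- p * of_real z) * \<Phi> z) \<partial>lborel)"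
    by (simp add: set_lebesgue_integral_def)
  also have "(\<lambda>z. indicator {0..T} z *\<^sub>R (exp (- p * of_real z) * \<Phi> z)) =
      (\<lambda>z. indicator {..T} z *\<^sub>R laplace_kernel \<Phi> p z)"
    by (auto simp: fun_eq_iff indicator_def laplace_kernel_def)
  finally show ?thesis .
qed

lemma laplace_kernel_tail:
  assumes "Re p > 0"
  shows "((\<lambda>T. integral (cbox 0 T) (\<lambda>z. exp (- p * of_real z) * \<Phi> z)) \<longlongrightarrow> integral\<^sup>L lborel (laplace_kernel \<Phi> p)) at_top"
  unfolding laplace_kernel_finite
proof (rule integral_dominated_convergence_at_top)
  show "integrable lborel (\<lambda>z. norm (laplace_kernel \<Phi> p z))"
    using laplace_kernel_integrable[OF assms] by (rule integrable_norm)
  show "\<forall>\<^sub>F T in at_top. AE z in lborel. norm (indicator {..T} z *\<^sub>R laplace_kernel \<Phi> p z) \<le> norm (laplace_kernel \<Phi> p z)"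
    by (intro always_eventually allI AE_I2) (auto simp: indicator_def)
  show "AE z in lborel. ((\<lambda>T. indicator {..T} z *\<^sub>R laplace_kernel \<Phi> p z) \<longlongrightarrow> laplace_kernel \<Phi> p z) at_top"
  proof (rule AE_I2)
    fix z
    show "((\<lambda>T. indicator {..T} z *\<^sub>R laplace_kernel \<Phi> p z) \<longlongrightarrow> laplace_kernel \<Phi> p z) at_top"
      by (rule tendsto_eventually, rule eventually_mono[OF eventually_ge_at_top[of z]]) simp
  qed
  have m: "laplace_kernel \<Phi> p \<in> borel_measurable lborel"
    using laplace_kernel_measurable by simp
  then show "laplace_kernel \<Phi> p \<in> borel_measurable lborel" .
  show "(\<lambda>z. indicator {..T} z *\<^sub>R laplace_kernel \<Phi> p z) \<in> borel_measurable lborel" for T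
    by (intro borel_measurable_scaleR m borel_measurable_indicator) simp
qed

text \<open>The truncated integrals are holomorphic by differentiation under the integral sign, and they converge
  uniformly on the disc of radius \<open>Re p / 2\<close> about \<open>p\<close> since there the kernel decays at least
  like \<open>exp (- \<delta> * z)\<close> with \<open>\<delta> = Re p / 2\<close>.\<close>

lemma laplace_kernel_holomorphic:
  "(\<lambda>p. integral\<^sup>L lborel (laplace_kernel \<Phi> p)) holomorphic_on {p. Re p > 0}"
proof (rule holomorphic_uniform_sequence)
  let ?J = "\<lambda>n p. integral (cbox 0 (real n)) (\<lambda>z. exp (- p * of_real z) * \<Phi> z)"
  show "open {p. Re p > 0}"
    by (rule open_halfspace_Re_gt)
  show "?J n holomorphic_on {p. Re p > 0}" for n
  proof (rule leibniz_rule_holomorphic)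
    fix p t assume "t \<in> cbox 0 (real n)"
    show "((\<lambda>p. exp (- p * of_real t) * \<Phi> t) has_field_derivative (- of_real t * exp (- p * of_real t) * \<Phi> t))
        (at p within {p. Re p > 0})"
      by (auto intro!: derivative_eq_intros)
  next
    fix p :: complex
    show "(\<lambda>z. exp (- p * of_real z) * \<Phi> z) integrable_on cbox 0 (real n)"
      by (intro integrable_continuous continuous_intros continuous_on_subset[OF cont]) auto
  next
    have "continuous_on ({p. Re p > 0} \<times> cbox 0 (real n)) (\<lambda>x. \<Phi> (snd x))"
      by (rule continuous_on_compose2[OF cont]) (auto intro!: continuous_intros)
    then show "continuous_on ({p. Re p > 0} \<times> cbox 0 (real n))
         (\<lambda>(p, t). - of_real t * exp (- p * of_real t) * \<Phi> t)"
      unfolding split_beta by (intro continuous_intros)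
  qed (rule convex_halfspace_Re_gt)
  fix p :: complex assume p: "p \<in> {p. Re p > 0}"
  define \<delta> where "\<delta> = Re p / 2"
  have \<delta>: "\<delta> > 0" using p by (simp add: \<delta>_def)
  have half: "\<delta> \<le> Re p'" if "p' \<in> cball p \<delta>" for p'
    using that abs_Re_le_cmod[of "p - p'"] by (simp add: dist_norm \<delta>_def)
  let ?w = "\<lambda>z. K * (indicator {0..} z * exp (- \<delta> * z))"
  have w: "integrable lborel ?w"
    by (intro integrable_mult_right exp_decay_integrable \<delta>)
  define tail where "tail n = (\<integral>z. indicator {real n<..} z * ?w z \<partial>lborel)" for n
  have tail: "tail \<longlonglongrightarrow> integral\<^sup>L lborel (\<lambda>z::real. 0)"
    unfolding tail_def
  proof (rule integral_dominated_convergence)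
    show "integrable lborel (\<lambda>z. norm (?w z))"
      using w by (rule integrable_norm)
    show "AE z in lborel. norm (indicator {real n<..} z * ?w z) \<le> norm (?w z)" for n
      by (intro AE_I2) (auto simp: indicator_def)
    show "AE z in lborel. (\<lambda>n. indicator {real n<..} z * ?w z) \<longlonglongrightarrow> 0"
    proof (rule AE_I2)
      fix z :: real
      obtain N where "z \<le> real N" using real_arch_simple by blast
      then show "(\<lambda>n. indicator {real n<..} z * ?w z) \<longlonglongrightarrow> 0"
        by (intro tendsto_eventually eventually_sequentiallyI[of N]) (auto simp: indicator_def)
    qed
  qed auto
  have diff: "norm (?J n p' - integral\<^sup>L lborel (laplace_kernel \<Phi> p')) \<le> tail n" if p': "p' \<in> cball p \<delta>" for n p'
  proof -
    have pos: "Re p' > 0" using half[OF p'] \<delta> by simp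
    have i1: "integrable lborel (\<lambda>z. indicator {..real n} z *\<^sub>R laplace_kernel \<Phi> p' z)"
      using laplace_kernel_integrable[OF pos] by (intro integrable_mult_indicator) auto
    have "?J n p' - integral\<^sup>L lborel (laplace_kernel \<Phi> p') =
        (\<integral>z. indicator {..real n} z *\<^sub>R laplace_kernel \<Phi> p' z - laplace_kernel \<Phi> p' z \<partial>lborel)"
      unfolding laplace_kernel_finite using i1 laplace_kernel_integrable[OF pos]
      by (rule Bochner_Integration.integral_diff [symmetric])
    also have "norm \<dots> \<le> tail n"
      unfolding tail_def
    proof (rule Bochner_Integration.integral_norm_bound_integral)
      show "integrable lborel (\<lambda>z. indicator {..real n} z *\<^sub>R laplace_kernel \<Phi> p' z - laplace_kernel \<Phi> p' z)"
        using i1 laplace_kernel_integrable[OF pos] by (rule Bochner_Integration.integrable_diff)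
      show "integrable lborel (\<lambda>z. indicator {real n<..} z * ?w z)"
        using integrable_mult_indicator[OF _ w, of "{real n<..}"] by simp
      show "norm (indicator {..real n} z *\<^sub>R laplace_kernel \<Phi> p' z - laplace_kernel \<Phi> p' z) \<le> indicator {real n<..} z * ?w z" for z
        using laplace_kernel_bound[OF half[OF p'], of z] by (auto simp: indicator_def)
    qed
    finally show ?thesis .
  qed
  show "\<exists>d>0. cball p d \<subseteq> {p. Re p > 0} \<and>
      uniform_limit (cball p d) ?J (\<lambda>p. integral\<^sup>L lborel (laplace_kernel \<Phi> p)) sequentially"
  proof (intro exI[of _ \<delta>] conjI \<delta>)
    show "cball p \<delta> \<subseteq> {p. Re p > 0}"
      using half \<delta> by fastforce
    show "uniform_limit (cball p \<delta>) ?J (\<lambda>p. integral\<^sup>L lborel (laplace_kernel \<Phi> p)) sequentially"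
    proof (rule uniform_limitI)
      fix \<epsilon> :: real assume "\<epsilon> > 0"
      then have "\<forall>\<^sub>F n in sequentially. tail n < \<epsilon>"
        using tail by (intro order_tendstoD(2)[of tail 0]) auto
      then show "\<forall>\<^sub>F n in sequentially. \<forall>p'\<in>cball p \<delta>. dist (?J n p') (integral\<^sup>L lborel (laplace_kernel \<Phi> p')) < \<epsilon>"
        by eventually_elim (unfold dist_norm, blast intro: le_less_trans[OF diff])
    qed
  qed
qed

lemma laplace_scaled:
  assumes \<epsilon>: "\<epsilon> > 0"
  shows "of_real \<epsilon> * integral\<^sup>L lborel (laplace_kernel \<Phi> (s * of_real \<epsilon>)) =
           (\<integral>v. indicator {0..} v *\<^sub>R (exp (- s * of_real v) * \<Phi> (v / \<epsilon>)) \<partial>lborel)"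
proof -
  have "(\<integral>v. indicator {0..} v *\<^sub>R (exp (- s * of_real v) * \<Phi> (v / \<epsilon>)) \<partial>lborel) =
     \<epsilon> *\<^sub>R (\<integral>z. indicator {0..} (\<epsilon> * z) *\<^sub>R (exp (- s * of_real (\<epsilon> * z)) * \<Phi> (\<epsilon> * z / \<epsilon>)) \<partial>lborel)"
    using lborel_integral_real_affine[of \<epsilon> "\<lambda>v. indicator {0..} v *\<^sub>R (exp (- s * of_real v) * \<Phi> (v / \<epsilon>))" 0] \<epsilon>
    by simp
  also have "(\<lambda>z. indicator {0..} (\<epsilon> * z) *\<^sub>R (exp (- s * of_real (\<epsilon> * z)) * \<Phi> (\<epsilon> * z / \<epsilon>))) = laplace_kernel \<Phi> (s * of_real \<epsilon>)"
    using \<epsilon> by (auto simp: fun_eq_iff laplace_kernel_def indicator_def zero_le_mult_iff mult_ac)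
  finally show ?thesis by (simp add: scaleR_conv_of_real)
qed

end

lemma laplace_const_one:
  assumes s: "Re s > 0"
  shows "integral\<^sup>L lborel (laplace_kernel (\<lambda>_. 1) s) = 1 / s"
proof (rule tendsto_unique)
  show "((\<lambda>T. integral (cbox 0 T) (\<lambda>z. exp (- s * of_real z) * 1)) \<longlongrightarrow> integral\<^sup>L lborel (laplace_kernel (\<lambda>_. 1) s)) at_top"
    using laplace_kernel_tail[of "\<lambda>_. 1" 1 s] s by simp
  have "s \<noteq> 0" using s by auto
  have "((\<lambda>T. exp (- Re s * T)) \<longlongrightarrow> 0) at_top"
    using s by real_asymp
  then have "((\<lambda>T. exp (- s * of_real T)) \<longlongrightarrow> 0) at_top"
    by (intro tendsto_norm_zero_cancel[of "\<lambda>T. exp (- s * of_real T)"]) simp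
  then have lim: "((\<lambda>T. 1 / s * (1 - exp (- s * of_real T))) \<longlongrightarrow> 1 / s * (1 - 0)) at_top"
    by (intro tendsto_intros)
  have ev: "\<forall>\<^sub>F T in at_top. 1 / s * (1 - exp (- s * of_real T)) = integral (cbox 0 T) (\<lambda>z. exp (- s * of_real z) * 1)"
    using eventually_ge_at_top[of 0]
  proof eventually_elim
    case (elim T)
    have "((\<lambda>z. exp (- s * of_real z) * 1) has_integral
        (- exp (- s * of_real T) / s) - (- exp (- s * of_real 0) / s)) {0..T}"
    proof (rule fundamental_theorem_of_calculus[OF elim])
      fix z
      have "((\<lambda>z. - exp (- s * z) / s) has_field_derivative exp (- s * of_real z) * 1) (at (complex_of_real z))"
        using \<open>s \<noteq> 0\<close> by (auto intro!: derivative_eq_intros)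
      then show "((\<lambda>z. - exp (- s * of_real z) / s) has_vector_derivative exp (- s * of_real z) * 1) (at z within {0..T})"
        by (rule has_vector_derivative_real_field)
    qed
    then show ?case
      by (simp only: cbox_interval integral_unique) (simp add: diff_divide_distrib)
  qed
  show "((\<lambda>T. integral (cbox 0 T) (\<lambda>z. exp (- s * of_real z) * 1)) \<longlongrightarrow> 1 / s) at_top"
    using Lim_transform_eventually[OF lim ev] by (simp only: diff_zero mult_1_right)
qed (rule trivial_limit_at_top_linorder)

text \<open>An Abelian theorem: after rescaling, \<open>p * \<integral> exp (- p * z) * \<Phi> z\<close> with \<open>p = s / (n + 1)\<close> becomes
  \<open>s * \<integral> exp (- s * v) * \<Phi> (v * (n + 1))\<close>, and dominated convergence replaces \<open>\<Phi>\<close> by its limit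
  at infinity.\<close>

lemma laplace_kernel_limit:
  assumes cont: "continuous_on {0..} \<Phi>" and bound: "\<And>z. z \<ge> 0 \<Longrightarrow> norm (\<Phi> z) \<le> K"
    and lim: "(\<Phi> \<longlongrightarrow> I) at_top" and s: "Re s > 0"
  shows "(\<lambda>n. (s / of_nat (Suc n)) * integral\<^sup>L lborel (laplace_kernel \<Phi> (s / of_nat (Suc n)))) \<longlonglongrightarrow> I"
proof -
  let ?g = "\<lambda>n v. indicator {0..} v *\<^sub>R (exp (- s * of_real v) * \<Phi> (v * real (Suc n)))"
  let ?w = "\<lambda>v. K * (indicator {0..} v * exp (- Re s * v))"
  have "(\<lambda>n. \<integral>v. ?g n v \<partial>lborel) \<longlonglongrightarrow> (\<integral>v. I * laplace_kernel (\<lambda>_. 1) s v \<partial>lborel)"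
  proof (rule integral_dominated_convergence)
    show "integrable lborel ?w"
      using s by (intro integrable_mult_right exp_decay_integrable)
    have c: "continuous_on {0..} (\<lambda>v. exp (- s * of_real v) * \<Phi> (v * real (Suc n)))" for n
      by (intro continuous_intros continuous_on_compose2[OF cont]) auto
    show "?g n \<in> borel_measurable lborel" for n
      using borel_measurable_continuous_on_indicator[OF _ c[of n]] by simp
    show "(\<lambda>v. I * laplace_kernel (\<lambda>_. 1) s v) \<in> borel_measurable lborel"
      using laplace_kernel_measurable[of "\<lambda>_. 1" 1 s] by simp
    show "AE v in lborel. norm (?g n v) \<le> ?w v" for n
      using bound by (intro AE_I2) (auto simp: indicator_def norm_mult mult.commute intro!: mult_right_mono)
    show "AE v in lborel. (\<lambda>n. ?g n v) \<longlonglongrightarrow> I * laplace_kernel (\<lambda>_. 1) s v"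
    proof (rule AE_mp[OF AE_lborel_singleton[of 0]], rule AE_I2, rule impI)
      fix v :: real assume "v \<noteq> 0"
      show "(\<lambda>n. ?g n v) \<longlonglongrightarrow> I * laplace_kernel (\<lambda>_. 1) s v"
      proof (cases "v > 0")
        case True
        then have "filterlim (\<lambda>n. v * real (Suc n)) at_top sequentially"
          by real_asymp
        from filterlim_compose[OF lim this]
        have "(\<lambda>n. exp (- s * of_real v) * \<Phi> (v * real (Suc n))) \<longlonglongrightarrow> exp (- s * of_real v) * I"
          by (intro tendsto_intros)
        then show ?thesis using True by (simp add: laplace_kernel_def mult.commute)
      next
        case False
        then show ?thesis using \<open>v \<noteq> 0\<close> by (simp add: laplace_kernel_def)
      qed
    qed
  qed
  then have "(\<lambda>n. s * (\<integral>v. ?g n v \<partial>lborel)) \<longlonglongrightarrow> s * (\<integral>v. I * laplace_kernel (\<lambda>_. 1) s v \<partial>lborel)"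
    by (intro tendsto_intros)
  moreover have "s * (\<integral>v. I * laplace_kernel (\<lambda>_. 1) s v \<partial>lborel) = I"
    using s laplace_const_one[OF s] by auto
  moreover have "s * (\<integral>v. ?g n v \<partial>lborel) = (s / of_nat (Suc n)) * integral\<^sup>L lborel (laplace_kernel \<Phi> (s / of_nat (Suc n)))" for n
  proof -
    have "of_real (1 / real (Suc n)) * integral\<^sup>L lborel (laplace_kernel \<Phi> (s * of_real (1 / real (Suc n)))) = (\<integral>v. ?g n v \<partial>lborel)"
      using laplace_scaled[OF cont bound, of "1 / real (Suc n)" s] by simp
    moreover have "s / of_nat (Suc n) = s * of_real (1 / real (Suc n))"
      by (simp add: field_simps)
    ultimately show ?thesis
      by (simp only: mult.assoc)
  qed
  ultimately show ?thesis by (simp only:)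
qed

section \<open>Termwise transformation where convergence is absolute\<close>

lemma gamma_density_norm: "of_real (norm (gamma_density z t)) = gamma_density (of_real (Re z)) t"
  using powr_of_real[of t "Re z - 1"]
  by (auto simp: gamma_density_def indicator_def norm_divide norm_powr_of_real)

lemma gamma_density_scaled:
  assumes "p > 0" "Re L > 0"
  shows "integrable lborel (\<lambda>z. gamma_density L (p * z))"
    and "(\<integral>z. gamma_density L (p * z) \<partial>lborel) = Gamma L / of_real p"
    and "(\<integral>z. norm (gamma_density L (p * z)) \<partial>lborel) = Gamma (Re L) / p"
proof -
  have 1: "integrable lborel (\<lambda>z. gamma_density L (p * z))" if "Re L > 0" for L
    using lborel_integrable_real_affine[OF gamma_density_lborel(1)[OF that], of p 0] assms by simp
  have 2: "(\<integral>z. gamma_density L (p * z) \<partial>lborel) = Gamma L / of_real p" if "Re L > 0" for L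
    using lborel_integral_real_affine[of p "gamma_density L" 0] gamma_density_lborel(2)[OF that] assms
    by (simp add: scaleR_conv_of_real field_simps)
  have "complex_of_real (\<integral>z. norm (gamma_density L (p * z)) \<partial>lborel) =
      (\<integral>z. gamma_density (of_real (Re L)) (p * z) \<partial>lborel)"
    by (simp add: integral_complex_of_real [symmetric] gamma_density_norm del: integral_complex_of_real)
  also have "\<dots> = of_real (Gamma (Re L) / p)"
    using 2[of "of_real (Re L)"] assms by (simp add: Gamma_complex_of_real)
  finally show "(\<integral>z. norm (gamma_density L (p * z)) \<partial>lborel) = Gamma (Re L) / p"
    by (simp only: of_real_eq_iff)
  show "integrable lborel (\<lambda>z. gamma_density L (p * z))" "(\<integral>z. gamma_density L (p * z) \<partial>lborel) = Gamma L / of_real p"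
    using 1 2 assms by auto
qed

lemma laplace_monomial_density:
  assumes "p > 0"
  shows "indicator {0<..} z *\<^sub>R (exp (- of_real p * of_real z) * of_real z powr (L - 1)) =
           of_real p powr (1 - L) * gamma_density L (p * z)"
proof (cases "z > 0")
  case True
  have "of_real p powr (1 - L) * of_real (p * z) powr (L - 1) = complex_of_real z powr (L - 1)"
    using True assms powr_of_real_mult[of p z "L - 1"]
    by (simp add: powr_diff)
  moreover have "exp (- of_real p * of_real z) = 1 / complex_of_real (exp (p * z))"
    by (simp add: exp_minus inverse_eq_divide exp_of_real [symmetric])
  ultimately show ?thesis
    using True assms by (simp add: gamma_density_def)
next
  case False
  then show ?thesis
    using assms by (simp add: gamma_density_def zero_less_mult_iff)
qed

lemma norm_powr_decreasing:
  fixes s u :: complex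
  assumes "s \<noteq> 0" "norm s < norm u" "\<nu> > 0"
  shows "norm (u powr (- of_real \<nu>)) < norm (s powr (- of_real \<nu>))"
proof -
  have "norm (w powr (- of_real \<nu>)) = norm w powr (- \<nu>)" if "w \<noteq> 0" for w :: complex
    using that by (simp add: powr_def norm_exp_eq_Re)
  moreover have "u \<noteq> 0" using assms by auto
  ultimately show ?thesis
    using assms powr_less_mono2_neg[of "- \<nu>" "norm s" "norm u"] by simp
qed

context
  fixes l s :: complex and \<nu> :: real and c :: "nat \<Rightarrow> complex"
  assumes l: "Re l > 0" and s: "Re s > 0" and \<nu>: "\<nu> > 0" and c: "entire_coeffs c"
    and conv: "summable (\<lambda>n. c n * Gamma (l + of_real \<nu> * of_nat n) * (s powr (- of_real \<nu>)) ^ n)"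
begin

abbreviation (input) "A n \<equiv> c n * Gamma (l + of_real \<nu> * of_nat n)"

lemma image_series_summable:
  assumes "norm (u :: complex) > norm s"
  shows "summable (\<lambda>n. A n * (u powr (- of_real \<nu>)) ^ n)"
proof -
  have "norm (u powr (- of_real \<nu>)) < norm (s powr (- of_real \<nu>))"
    using s assms \<nu> by (intro norm_powr_decreasing) auto
  from powser_inside[OF conv this] show ?thesis .
qed

text \<open>The transform of the absolute values of the terms has \<open>\<Gamma>(Re l + \<nu> * n)\<close> in place of
  \<open>|\<Gamma>(l + \<nu> * n)|\<close>; the quotient of the two is bounded by \<open>Gamma_shift_bound\<close>.\<close>

lemma image_series_real_summable:
  fixes p :: real
  assumes "p > norm s"
  shows "summable (\<lambda>n. norm (c n) * Gamma (Re l + \<nu> * real n) * (p powr (- \<nu>)) ^ n)"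
proof -
  have p: "p > 0" using assms norm_ge_zero[of s] by linarith
  have nz: "norm (Gamma l) > 0" using Gamma_nonzero_right_halfplane[OF l] by simp
  have "norm (complex_of_real p powr (- of_real \<nu>)) < norm (s powr (- of_real \<nu>))"
    using s assms p \<nu> by (intro norm_powr_decreasing) auto
  also have "of_real p powr (- of_real \<nu>) = complex_of_real (p powr (- \<nu>))"
    using p by (subst powr_of_real [symmetric]) auto
  finally have "norm (complex_of_real (p powr (- \<nu>))) < norm (s powr (- of_real \<nu>))" .
  from powser_insidea[OF conv this] have "summable (\<lambda>n. Gamma (Re l) / norm (Gamma l) * (norm (A n) * (p powr (- \<nu>)) ^ n))"
    by (intro summable_mult) (simp add: norm_mult norm_power)
  then show ?thesis
  proof (rule summable_comparison_test'[of _ 0])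
    fix n
    have g: "Gamma (Re l + \<nu> * real n) \<ge> 0"
      using l \<nu> by (intro less_imp_le Gamma_real_pos) (simp add: add_pos_nonneg)
    have "Gamma (Re l + \<nu> * real n) * norm (Gamma l) \<le> Gamma (Re l) * norm (Gamma (l + of_real \<nu> * of_nat n))"
      using Gamma_shift_bound[OF l, of "\<nu> * real n"] \<nu> by simp
    then have "Gamma (Re l + \<nu> * real n) \<le> Gamma (Re l) / norm (Gamma l) * norm (Gamma (l + of_real \<nu> * of_nat n))"
      using nz by (simp add: field_simps)
    then have "norm (c n) * Gamma (Re l + \<nu> * real n) * (p powr (- \<nu>)) ^ n \<le>
       norm (c n) * (Gamma (Re l) / norm (Gamma l) * norm (Gamma (l + of_real \<nu> * of_nat n))) * (p powr (- \<nu>)) ^ n"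
      by (intro mult_right_mono mult_left_mono) auto
    then show "norm (norm (c n) * Gamma (Re l + \<nu> * real n) * (p powr (- \<nu>)) ^ n) \<le>
       Gamma (Re l) / norm (Gamma l) * (norm (A n) * (p powr (- \<nu>)) ^ n)"
      using g by (simp add: norm_mult mult_ac abs_mult)
  qed
qed

lemma laplace_gen_powser_termwise:
  fixes p :: real
  assumes ps: "p > norm s"
  shows "set_integrable lborel {0<..} (\<lambda>z. exp (- of_real p * of_real z) * gen_powser (l - 1) \<nu> c z)"
    and "(LINT z:{0<..}|lborel. exp (- of_real p * of_real z) * gen_powser (l - 1) \<nu> c z) =
           of_real p powr (- l) * (\<Sum>n. A n * (of_real p powr (- of_real \<nu>)) ^ n)"
proof -
  have p: "p > 0" using assms norm_ge_zero[of s] by linarith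
  define L where "L n = l + of_real \<nu> * of_nat n" for n
  have ReL: "Re (L n) > 0" for n
    using l \<nu> by (simp add: L_def add_pos_nonneg)
  define F where "F n z = c n * (of_real p powr (1 - L n) * gamma_density (L n) (p * z))" for n z
  have expo: "p powr (1 - Re (L n)) / p = p powr (- Re l) * (p powr (- \<nu>)) ^ n" for n
    using p by (simp add: L_def powr_diff powr_minus powr_add powr_powr powr_realpow [symmetric] field_simps)
  have cexpo: "of_real p powr (1 - L n) / of_real p = of_real p powr (- l) * (complex_of_real p powr (- of_real \<nu>)) ^ n" for n
  proof -
    have "of_real p powr (- l + of_real (- \<nu>) * of_nat n) = of_real p powr (- l) * complex_of_real (p powr (- \<nu>)) ^ n"
      using p by (rule powr_of_real_power)
    moreover have "complex_of_real (p powr (- \<nu>)) = of_real p powr (- of_real \<nu>)"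
      using p by (simp add: powr_of_real [symmetric])
    moreover have "1 - L n = (- l + of_real (- \<nu>) * of_nat n) + 1"
      by (simp add: L_def)
    ultimately show ?thesis
      using p by (simp only: powr_add powr_one_eq_one) simp
  qed
  have F_int: "integrable lborel (F n)" for n
    unfolding F_def using gamma_density_scaled(1)[OF p ReL] by (intro integrable_mult_right)
  have F_norm: "(\<integral>z. norm (F n z) \<partial>lborel) = p powr (- Re l) * (norm (c n) * Gamma (Re l + \<nu> * real n) * (p powr (- \<nu>)) ^ n)" for n
  proof -
    have "(\<integral>z. norm (F n z) \<partial>lborel) = norm (c n) * (p powr (1 - Re (L n))) * (Gamma (Re (L n)) / p)"
      using gamma_density_scaled(3)[OF p ReL] p by (simp add: F_def norm_mult norm_powr_of_real)
    also have "\<dots> = norm (c n) * Gamma (Re (L n)) * (p powr (1 - Re (L n)) / p)"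
      by simp
    finally show ?thesis
      unfolding expo by (simp add: L_def)
  qed
  have F_eq: "F n z = indicator {0<..} z *\<^sub>R (exp (- of_real p * of_real z) * of_real z powr (l - 1) * (c n * of_real (z powr \<nu>) ^ n))" for n z
  proof (cases "z > 0")
    case True
    have "of_real z powr (L n - 1) = of_real z powr (l - 1) * complex_of_real (z powr \<nu>) ^ n"
      using powr_of_real_power[OF True, of "l - 1" \<nu> n] by (simp add: L_def algebra_simps)
    then show ?thesis
      using True unfolding F_def laplace_monomial_density[OF p, symmetric] by simp
  next
    case False
    then show ?thesis
      unfolding F_def laplace_monomial_density[OF p, symmetric] by simp
  qed
  have sums: "summable (\<lambda>n. norm (F n z))" for z
    unfolding F_eq using entire_coeffs_norm_summable[OF c, of "z powr \<nu>"]
    by (cases "z > 0") (auto simp: norm_mult norm_power intro: summable_mult)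
  have suminf: "(\<Sum>n. F n z) = indicator {0<..} z *\<^sub>R (exp (- of_real p * of_real z) * gen_powser (l - 1) \<nu> c z)" for z
  proof (cases "z > 0")
    case True
    have "summable (\<lambda>n. c n * of_real (z powr \<nu>) ^ n)"
      using c by (simp add: entire_coeffs_def)
    from suminf_mult[OF this, of "exp (- of_real p * of_real z) * of_real z powr (l - 1)"]
    show ?thesis
      using True by (simp add: F_eq gen_powser_def mult_ac)
  qed (simp add: F_eq)
  have sn: "summable (\<lambda>n. \<integral>z. norm (F n z) \<partial>lborel)"
    unfolding F_norm by (intro summable_mult image_series_real_summable ps)
  show "set_integrable lborel {0<..} (\<lambda>z. exp (- of_real p * of_real z) * gen_powser (l - 1) \<nu> c z)"
    unfolding set_integrable_def suminf [symmetric]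
    by (rule integrable_suminf[OF F_int AE_I2 sn]) (rule sums)
  have term_eq: "integral\<^sup>L lborel (F n) = of_real p powr (- l) * (A n * (of_real p powr (- of_real \<nu>)) ^ n)" for n
  proof -
    have "integral\<^sup>L lborel (F n) = c n * Gamma (L n) * (of_real p powr (1 - L n) / of_real p)"
      unfolding F_def using gamma_density_scaled(2)[OF p ReL, of n] by simp
    then show ?thesis
      unfolding cexpo by (simp add: L_def mult_ac)
  qed
  have "(LINT z:{0<..}|lborel. exp (- of_real p * of_real z) * gen_powser (l - 1) \<nu> c z) = (\<Sum>n. integral\<^sup>L lborel (F n))"
    unfolding set_lebesgue_integral_def suminf [symmetric]
    by (rule integral_suminf[OF F_int AE_I2 sn]) (rule sums)
  also have "\<dots> = of_real p powr (- l) * (\<Sum>n. A n * (of_real p powr (- of_real \<nu>)) ^ n)"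
    unfolding term_eq using image_series_summable[of "of_real p"] ps p by (intro suminf_mult) simp
  finally show "(LINT z:{0<..}|lborel. exp (- of_real p * of_real z) * gen_powser (l - 1) \<nu> c z) =
           of_real p powr (- l) * (\<Sum>n. A n * (of_real p powr (- of_real \<nu>)) ^ n)" .
qed

end

section \<open>Laplace transforms that converge only conditionally\<close>

context
  fixes F :: "real \<Rightarrow> complex"
  assumes F_cont: "continuous_on {0<..} F" and F_int: "F integrable_on {0<..}"
begin

lemma integrable_initial: "F integrable_on {0..T}"
proof -
  have "F integrable_on {0..}"
    using F_int by (rule integrable_spike_set)
      (auto intro: negligible_subset[of "{0}"] negligible_subset[of "{}"])
  then show ?thesis
    by (rule integrable_on_subinterval) auto
qed

lemma primitive_continuous: "continuous_on {0..} (\<lambda>T. integral {0..T} F)"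
  unfolding continuous_on_eq_continuous_within
proof
  fix T :: real assume "T \<in> {0..}"
  then have "continuous (at T within {0..T + 1}) (\<lambda>T. integral {0..T} F)"
    using indefinite_integral_continuous_1[OF integrable_initial, of "T + 1"]
    by (simp add: continuous_on_eq_continuous_within)
  moreover have "at T within {0..T + 1} = at T within {0..}"
    by (rule at_within_nhd[of _ "{..<T + 1}"]) auto
  ultimately show "continuous (at T within {0..}) (\<lambda>T. integral {0..T} F)"
    by simp
qed

lemma primitive_derivative:
  assumes "T > 0"
  shows "((\<lambda>T. integral {0..T} F) has_vector_derivative F T) (at T)"
proof -
  have "isCont F T"
    using F_cont assms by (simp add: continuous_on_eq_continuous_at)
  then have "((\<lambda>u. integral {0..u} F) has_vector_derivative F T) (at T within ({0..T + 1} - {}))"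
    using assms by (intro integral_has_vector_derivative_continuous_at integrable_initial)
      (auto intro: continuous_at_imp_continuous_at_within)
  moreover have "at T within ({0..T + 1} - {}) = at T"
    using assms by (simp add: at_within_Icc_at)
  ultimately show ?thesis by simp
qed

lemma primitive_bounded:
  obtains K where "\<And>T. T \<ge> 0 \<Longrightarrow> norm (integral {0..T} F) \<le> K"
proof -
  let ?\<Phi> = "\<lambda>T. integral {0..T} F"
  have "((\<lambda>T. norm (?\<Phi> T)) \<longlongrightarrow> norm (integral {0<..} F)) at_top"
    by (intro tendsto_norm improper_integral_tendsto F_int)
  then have "\<forall>\<^sub>F T in at_top. norm (?\<Phi> T) < norm (integral {0<..} F) + 1"
    by (rule order_tendstoD(2)) simp
  then obtain B where B: "\<And>T. T \<ge> B \<Longrightarrow> norm (?\<Phi> T) < norm (integral {0<..} F) + 1"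
    by (auto simp: eventually_at_top_linorder)
  have "compact (?\<Phi> ` {0..B})"
    by (intro compact_continuous_image continuous_on_subset[OF primitive_continuous]) auto
  then have "bounded (?\<Phi> ` {0..B})"
    by (rule compact_imp_bounded)
  then obtain C where "\<forall>w \<in> ?\<Phi> ` {0..B}. norm w \<le> C"
    unfolding bounded_iff by blast
  then have C: "norm (?\<Phi> T) \<le> C" if "T \<in> {0..B}" for T
    using that by blast
  show ?thesis
  proof (rule that[of "max C (norm (integral {0<..} F) + 1)"])
    fix T :: real assume "T \<ge> 0"
    then show "norm (?\<Phi> T) \<le> max C (norm (integral {0<..} F) + 1)"
      using B[of T] C[of T] by (cases "T \<le> B") auto
  qed
qed

text \<open>Integration by parts against the primitive trades the possibly conditionally convergent
  integrand for a bounded continuous one.\<close>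

lemma integral_exp_by_parts:
  assumes p: "Re p > 0" and int: "set_integrable lborel {0<..} (\<lambda>z. exp (- p * of_real z) * F z)"
  shows "(LINT z:{0<..}|lborel. exp (- p * of_real z) * F z) =
           p * integral\<^sup>L lborel (laplace_kernel (\<lambda>T. integral {0..T} F) p)"
proof -
  let ?\<Phi> = "\<lambda>T. integral {0..T} F"
  let ?G = "\<lambda>T. exp (- p * of_real T) * ?\<Phi> T"
  obtain K where K: "\<And>T. T \<ge> 0 \<Longrightarrow> norm (?\<Phi> T) \<le> K"
    using primitive_bounded by blast
  have parts: "integral {0..T} (\<lambda>z. exp (- p * of_real z) * F z) = ?G T + p * integral (cbox 0 T) ?G"
    if T: "T \<ge> 0" for T
  proof -
    have contG: "continuous_on {0..T} ?G"
      by (intro continuous_intros continuous_on_subset[OF primitive_continuous]) auto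
    have "((\<lambda>z. exp (- p * of_real z) * F z - p * ?G z) has_integral ?G T - ?G 0) {0..T}"
    proof (rule fundamental_theorem_of_calculus_interior[OF T contG])
      fix z assume z: "z \<in> {0<..<T}"
      have "((\<lambda>z. exp (- p * z)) has_field_derivative - p * exp (- p * of_real z)) (at (complex_of_real z))"
        by (auto intro!: derivative_eq_intros)
      then have "((\<lambda>z. exp (- p * of_real z)) has_vector_derivative - p * exp (- p * of_real z)) (at z)"
        by (rule has_vector_derivative_real_field)
      from has_vector_derivative_mult[OF this primitive_derivative[of z]] z
      show "(?G has_vector_derivative exp (- p * of_real z) * F z - p * ?G z) (at z)"
        by (simp add: algebra_simps)
    qed
    moreover have "((\<lambda>z. p * ?G z) has_integral p * integral {0..T} ?G) {0..T}"
      by (intro has_integral_mult_right integrable_integral integrable_continuous_real contG)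
    ultimately have "((\<lambda>z. (exp (- p * of_real z) * F z - p * ?G z) + p * ?G z) has_integral
        (?G T - ?G 0) + p * integral {0..T} ?G) {0..T}"
      by (rule has_integral_add)
    then show ?thesis
      by (simp add: integral_unique cbox_interval)
  qed
  have "((\<lambda>T. exp (- Re p * T)) \<longlongrightarrow> 0) at_top"
    using p by real_asymp
  then have "((\<lambda>T. exp (- Re p * T) * K) \<longlongrightarrow> 0) at_top"
    by (rule tendsto_mult_left_zero)
  then have "(?G \<longlongrightarrow> 0) at_top"
  proof (rule Lim_null_comparison[rotated])
    show "\<forall>\<^sub>F T in at_top. norm (?G T) \<le> exp (- Re p * T) * K"
      using eventually_ge_at_top[of 0]
      by eventually_elim (simp add: norm_mult K)
  qed
  then have "((\<lambda>T. ?G T + p * integral (cbox 0 T) ?G) \<longlongrightarrow> 0 + p * integral\<^sup>L lborel (laplace_kernel ?\<Phi> p)) at_top"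
    by (intro tendsto_intros laplace_kernel_tail[OF primitive_continuous K p])
  moreover have "\<forall>\<^sub>F T in at_top. ?G T + p * integral (cbox 0 T) ?G = integral {0..T} (\<lambda>z. exp (- p * of_real z) * F z)"
    using eventually_ge_at_top[of 0] by eventually_elim (rule parts [symmetric])
  ultimately have "((\<lambda>T. integral {0..T} (\<lambda>z. exp (- p * of_real z) * F z)) \<longlongrightarrow>
      0 + p * integral\<^sup>L lborel (laplace_kernel ?\<Phi> p)) at_top"
    by (rule Lim_transform_eventually)
  moreover have "((\<lambda>T. integral {0..T} (\<lambda>z. exp (- p * of_real z) * F z)) \<longlongrightarrow>
      integral {0<..} (\<lambda>z. exp (- p * of_real z) * F z)) at_top"
    using set_borel_integral_eq_integral(1)[OF int] by (rule improper_integral_tendsto)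
  ultimately have "integral {0<..} (\<lambda>z. exp (- p * of_real z) * F z) = p * integral\<^sup>L lborel (laplace_kernel ?\<Phi> p)"
    using tendsto_unique[OF trivial_limit_at_top_linorder] by fastforce
  then show ?thesis
    using set_borel_integral_eq_integral(2)[OF int] by simp
qed

end

text \<open>An intersection of two open half planes that both have \<open>s\<close> on their boundary. On the first,
  \<open>Re (u - s) > 0\<close>; on the second \<open>norm u > norm s\<close>, so that the transformed series converges.
  The region is convex and contains all large real numbers and the points \<open>r * s\<close> with \<open>r > 1\<close>.\<close>

definition laplace_domain :: "complex \<Rightarrow> complex set" where
  "laplace_domain s = {u. Re s < Re u \<and> (norm s)\<^sup>2 < Re (u * cnj s)}"

lemma laplace_domain_open_connected:
  "open (laplace_domain s)" "connected (laplace_domain s)"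
proof -
  have eq: "laplace_domain s = {u. Re s < Re u} \<inter> {u. inner s u > (norm s)\<^sup>2}"
    by (auto simp: laplace_domain_def inner_complex_def algebra_simps)
  show "open (laplace_domain s)"
    unfolding eq by (intro open_Int open_halfspace_Re_gt open_halfspace_gt)
  show "connected (laplace_domain s)"
    unfolding eq by (intro convex_connected convex_Int convex_halfspace_Re_gt convex_halfspace_gt)
qed

lemma laplace_domain_norm:
  assumes "u \<in> laplace_domain s" "Re s > 0"
  shows "norm s < norm u" "Re u > 0"
proof -
  have "norm s * norm s < Re (u * cnj s)"
    using assms by (simp add: laplace_domain_def power2_eq_square)
  also have "\<dots> \<le> norm u * norm s"
    using complex_Re_le_cmod[of "u * cnj s"] by (simp add: norm_mult)
  finally show "norm s < norm u"
    by (rule mult_less_cancel_right_pos[THEN iffD1, rotated]) (use assms in auto)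
  show "Re u > 0"
    using assms by (simp add: laplace_domain_def)
qed

text \<open>The integral and the series may both converge only conditionally at \<open>s\<close>. The equality is known for
  real \<open>p > norm s\<close>, continues analytically to \<open>laplace_domain s\<close>, and passes to the boundary point
  \<open>s\<close> by an Abelian theorem on either side.\<close>

theorem laplace_gen_powser:
  assumes l: "Re l > 0" and s: "Re s > 0" and \<nu>: "\<nu> > 0" and c: "entire_coeffs c"
    and conv: "summable (\<lambda>n. c n * Gamma (l + of_real \<nu> * of_nat n) * (s powr (- of_real \<nu>)) ^ n)"
    and int: "(\<lambda>z. exp (- s * of_real z) * gen_powser (l - 1) \<nu> c z) integrable_on {0<..}"
  shows "integral {0<..} (\<lambda>z. exp (- s * of_real z) * gen_powser (l - 1) \<nu> c z) =
           s powr (- l) * (\<Sum>n. c n * Gamma (l + of_real \<nu> * of_nat n) * (s powr (- of_real \<nu>)) ^ n)"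
proof -
  define A where "A n = c n * Gamma (l + of_real \<nu> * of_nat n)" for n
  define F where "F = (\<lambda>z. exp (- s * of_real z) * gen_powser (l - 1) \<nu> c z)"
  define \<Phi> where "\<Phi> = (\<lambda>T. integral {0..T} F)"
  define J where "J p = integral\<^sup>L lborel (laplace_kernel \<Phi> p)" for p
  define S where "S X = (\<Sum>n. A n * X ^ n)" for X :: complex
  have F_cont: "continuous_on {0<..} F"
    unfolding F_def by (intro continuous_intros gen_powser_continuous_on c)
  have F_int: "F integrable_on {0<..}"
    using int by (simp add: F_def)
  note prim = primitive_continuous[OF F_cont F_int, folded \<Phi>_def]
  obtain K where K: "\<And>T. T \<ge> 0 \<Longrightarrow> norm (\<Phi> T) \<le> K"
    using primitive_bounded[OF F_cont F_int] unfolding \<Phi>_def by blast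
  have s0: "s \<noteq> 0" using s by auto
  have convA: "summable (\<lambda>n. A n * (s powr (- of_real \<nu>)) ^ n)"
    using conv by (simp add: A_def)

  define D where "D u = (u - s) * J (u - s) - u powr (- l) * S (u powr (- of_real \<nu>))" for u
  have D_real: "D (of_real p) = 0" if p: "p > norm s" for p :: real
  proof -
    have p0: "p > 0" using p norm_ge_zero[of s] by linarith
    have pos: "Re (of_real p - s) > 0"
      using p complex_Re_le_cmod[of s] by simp
    have eq: "exp (- (of_real p - s) * of_real z) * F z = exp (- of_real p * of_real z) * gen_powser (l - 1) \<nu> c z" for z
      by (simp add: F_def exp_add [symmetric] mult.assoc [symmetric] algebra_simps)
    note tw = laplace_gen_powser_termwise[OF l s \<nu> c conv p, folded eq]
    show ?thesis
      using integral_exp_by_parts[OF F_cont F_int pos tw(1)] tw(2)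
      by (simp add: D_def J_def S_def A_def \<Phi>_def)
  qed
  have D_holo: "D holomorphic_on laplace_domain s"
  proof -
    have J1: "J holomorphic_on {p. Re p > 0}"
      unfolding J_def using laplace_kernel_holomorphic[OF prim K] .
    have "(J \<circ> (\<lambda>u. u - s)) holomorphic_on laplace_domain s"
      by (rule holomorphic_on_compose_gen[OF _ J1]) (auto intro!: holomorphic_intros simp: laplace_domain_def)
    then have J: "(\<lambda>u. J (u - s)) holomorphic_on laplace_domain s"
      by (simp add: o_def)
    let ?r = "norm (s powr (- of_real \<nu>))"
    have "S holomorphic_on ball 0 ?r"
    proof (rule power_series_holomorphic)
      fix X :: complex assume "X \<in> ball 0 ?r"
      then have "summable (\<lambda>n. A n * X ^ n)"
        by (intro powser_inside[OF convA]) simp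
      then show "(\<lambda>n. A n * (X - 0) ^ n) sums S X"
        by (simp add: S_def summable_sums)
    qed
    moreover have "(\<lambda>u. u powr (- of_real \<nu>)) holomorphic_on laplace_domain s"
      using laplace_domain_norm(2)[OF _ s]
      by (intro holomorphic_intros) (force simp: complex_nonpos_Reals_iff)
    moreover have "(\<lambda>u. u powr (- of_real \<nu>)) ` laplace_domain s \<subseteq> ball 0 ?r"
    proof
      fix X assume "X \<in> (\<lambda>u. u powr (- of_real \<nu>)) ` laplace_domain s"
      then obtain u where u: "u \<in> laplace_domain s" "X = u powr (- of_real \<nu>)" by auto
      then show "X \<in> ball 0 ?r"
        using norm_powr_decreasing[OF s0 laplace_domain_norm(1)[OF u(1) s] \<nu>] by simp
    qed
    ultimately have "(S \<circ> (\<lambda>u. u powr (- of_real \<nu>))) holomorphic_on laplace_domain s"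
      by (intro holomorphic_on_compose_gen)
    then have SP: "(\<lambda>u. S (u powr (- of_real \<nu>))) holomorphic_on laplace_domain s"
      by (simp add: o_def)
    have P: "(\<lambda>u. u powr (- l)) holomorphic_on laplace_domain s"
      using laplace_domain_norm(2)[OF _ s]
      by (intro holomorphic_intros) (force simp: complex_nonpos_Reals_iff)
    show ?thesis
      unfolding D_def
      by (intro holomorphic_on_diff holomorphic_on_mult holomorphic_on_ident holomorphic_on_const J SP P)
  qed
  \<comment> \<open>Real numbers beyond \<open>R\<close> satisfy the second inequality defining the domain.\<close>
  define R where "R = (norm s)\<^sup>2 / Re s"
  have R: "norm s \<le> R"
  proof -
    have "norm s * Re s \<le> norm s * norm s"
      by (intro mult_left_mono complex_Re_le_cmod) simp
    then show ?thesis
      using s by (simp add: R_def field_simps power2_eq_square)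
  qed
  have R_domain: "of_real p \<in> laplace_domain s" if "p > R" for p
  proof -
    have "Re s < p"
      using that R complex_Re_le_cmod[of s] by linarith
    moreover have "(norm s)\<^sup>2 < p * Re s"
      using that s by (simp add: R_def field_simps)
    ultimately show ?thesis
      by (simp add: laplace_domain_def)
  qed
  have D_zero: "D u = 0" if u: "u \<in> laplace_domain s" for u
  proof (rule analytic_continuation[OF D_holo laplace_domain_open_connected, of "of_real ` {R<..}" "of_real (R + 1)"])
    show "of_real ` {R<..} \<subseteq> laplace_domain s"
      using R_domain by auto
    show "of_real (R + 1) \<in> laplace_domain s"
      by (rule R_domain) simp
    have "(R + 1) islimpt {R<..}"
      by (rule interior_limit_point) (simp add: interior_open)
    then show "complex_of_real (R + 1) islimpt of_real ` {R<..}"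
      by (rule islimpt_isCont_image) (auto simp: eventually_at_filter simp del: of_real_add)
    show "D z = 0" if "z \<in> of_real ` {R<..}" for z
      using that D_real R by auto
  qed (use u in simp)

  \<comment> \<open>Approach \<open>s\<close> radially: then \<open>u n - s\<close> is a positive multiple of \<open>s\<close>, and the argument of the
    series is its value at \<open>s\<close> times a real factor below 1.\<close>
  define u where "u n = s * (1 + 1 / of_nat (Suc n))" for n
  have u_real: "u n = of_real (1 + 1 / real (Suc n)) * s" for n
    by (simp add: u_def)
  have "u n \<in> laplace_domain s" for n
  proof -
    have "Re s < (1 + 1 / real (Suc n)) * Re s"
      using s by (simp add: field_simps)
    moreover have "(norm s)\<^sup>2 < (1 + 1 / real (Suc n)) * (norm s)\<^sup>2"
      using s0 by (simp add: field_simps)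
    moreover have "Re (u n * cnj s) = (1 + 1 / real (Suc n)) * (norm s)\<^sup>2"
      unfolding u_real by (simp only: mult.assoc complex_mult_cnj cmod_power2) simp
    ultimately show ?thesis
      by (simp add: laplace_domain_def u_real del: of_real_add)
  qed
  then have u_eq: "(u n - s) * J (u n - s) = u n powr (- l) * S (u n powr (- of_real \<nu>))" for n
    using D_zero[of "u n"] by (simp add: D_def)
  have "u n - s = s / of_nat (Suc n)" for n
    by (simp add: u_def algebra_simps)
  then have lim1: "(\<lambda>n. (u n - s) * J (u n - s)) \<longlonglongrightarrow> integral {0<..} F"
    using laplace_kernel_limit[OF prim K _ s, of "integral {0<..} F"] improper_integral_tendsto[OF F_int]
    by (simp add: J_def \<Phi>_def)

  define r where "r n = (1 + 1 / real (Suc n)) powr (- \<nu>)" for n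
  have u_powr: "u n powr (- of_real \<nu>) = s powr (- of_real \<nu>) * of_real (r n)" for n
  proof -
    have "u n powr (- of_real \<nu>) = of_real (1 + 1 / real (Suc n)) powr (- of_real \<nu>) * s powr (- of_real \<nu>)"
      unfolding u_real by (rule powr_times_real_left) (auto simp: add_nonneg_nonneg)
    also have "of_real (1 + 1 / real (Suc n)) powr (- of_real \<nu>) = complex_of_real (r n)"
      unfolding r_def by (subst powr_of_real [symmetric]) (auto simp: add_nonneg_nonneg)
    finally show ?thesis by (simp add: mult.commute)
  qed
  have "filterlim r (at_left 1) sequentially"
    unfolding r_def using \<nu> by real_asymp
  from filterlim_compose[OF Abel_limit[OF convA] this]
  have "(\<lambda>n. S (u n powr (- of_real \<nu>))) \<longlonglongrightarrow> S (s powr (- of_real \<nu>))"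
    by (simp add: u_powr S_def power_mult_distrib mult.assoc)
  moreover have "(\<lambda>n. u n powr (- l)) \<longlonglongrightarrow> s powr (- l)"
  proof (rule tendsto_powr_complex)
    have "(\<lambda>n. complex_of_real (1 + 1 / real (Suc n))) \<longlonglongrightarrow> of_real 1"
      by (intro tendsto_of_real) real_asymp
    then have "(\<lambda>n. of_real (1 + 1 / real (Suc n)) * s) \<longlonglongrightarrow> of_real 1 * s"
      by (rule tendsto_mult_right)
    then show "u \<longlonglongrightarrow> s"
      unfolding u_real by simp
  qed (use s in \<open>auto simp: complex_nonpos_Reals_iff\<close>)
  ultimately have "(\<lambda>n. u n powr (- l) * S (u n powr (- of_real \<nu>))) \<longlonglongrightarrow> s powr (- l) * S (s powr (- of_real \<nu>))"
    by (intro tendsto_mult)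
  then have "integral {0<..} F = s powr (- l) * S (s powr (- of_real \<nu>))"
    using lim1 unfolding u_eq by (rule LIMSEQ_unique[rotated])
  then show ?thesis
    by (simp add: F_def S_def A_def)
qed

section \<open>The generalized k-Mittag-Leffler function\<close>

text \<open>The coefficients of the Mittag-Leffler series with the powers of \<open>k\<close> collected in the form in which they
  appear in the Fox-Wright series.\<close>

definition ml_coeff :: "real \<Rightarrow> complex \<Rightarrow> complex \<Rightarrow> complex \<Rightarrow> real \<Rightarrow> nat \<Rightarrow> complex" where
  "ml_coeff k \<xi> \<zeta> \<theta> q n = of_real k powr (1 - \<zeta> / of_real k) / Gamma (\<theta> / of_real k) *
     (of_real k powr (of_real q - \<xi> / of_real k)) ^ n *
     (Gamma (\<theta> / of_real k + of_real q * of_nat n) * rGamma (\<zeta> / of_real k + \<xi> / of_real k * of_nat n) / fact n)"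

lemma k_mittag_leffler_term_eq:
  assumes k: "k > 0"
  shows "k_mittag_leffler_term k \<xi> \<zeta> \<theta> q z n = ml_coeff k \<xi> \<zeta> \<theta> q n * z ^ n"
proof -
  define \<kappa> where "\<kappa> = complex_of_real k"
  have \<kappa>: "\<kappa> \<noteq> 0" using k by (simp add: \<kappa>_def)
  have arg: "(of_nat n * \<xi> + \<zeta>) / \<kappa> = \<zeta> / \<kappa> + \<xi> / \<kappa> * of_nat n"
    by (simp add: add_divide_distrib)
  have "\<kappa> powr of_real (real n * q) * inverse (\<kappa> powr (\<zeta> / \<kappa> + \<xi> / \<kappa> * of_nat n - 1)) =
      \<kappa> powr (of_real (real n * q) - (\<zeta> / \<kappa> + \<xi> / \<kappa> * of_nat n - 1))"
    by (simp only: powr_minus [symmetric] powr_add [symmetric] diff_conv_add_uminus)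
  also have "of_real (real n * q) - (\<zeta> / \<kappa> + \<xi> / \<kappa> * of_nat n - 1) =
      (1 - \<zeta> / \<kappa>) + of_nat n * (of_real q - \<xi> / \<kappa>)"
    by (simp add: algebra_simps)
  also have "\<kappa> powr \<dots> = \<kappa> powr (1 - \<zeta> / \<kappa>) * (\<kappa> powr (of_real q - \<xi> / \<kappa>)) ^ n"
    using \<kappa> by (simp only: powr_add) (simp add: powr_def exp_of_nat_mult [symmetric] mult_ac)
  finally have K: "\<kappa> powr of_real (real n * q) * inverse (\<kappa> powr (\<zeta> / \<kappa> + \<xi> / \<kappa> * of_nat n - 1)) =
      \<kappa> powr (1 - \<zeta> / \<kappa>) * (\<kappa> powr (of_real q - \<xi> / \<kappa>)) ^ n" .
  have "k_mittag_leffler_term k \<xi> \<zeta> \<theta> q z n =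
     (\<kappa> powr of_real (real n * q) * inverse (\<kappa> powr (\<zeta> / \<kappa> + \<xi> / \<kappa> * of_nat n - 1))) *
     inverse (Gamma (\<theta> / \<kappa>)) * (Gamma (\<theta> / \<kappa> + of_real (real n * q)) * rGamma (\<zeta> / \<kappa> + \<xi> / \<kappa> * of_nat n)) *
     (z ^ n * inverse (fact n))"
    unfolding k_mittag_leffler_term_def k_pochhammer_def real_pochhammer_def k_gamma_def \<kappa>_def [symmetric] arg
      rGamma_inverse_Gamma
    by (simp only: divide_inverse inverse_mult_distrib mult_ac)
  then show ?thesis
    unfolding K unfolding ml_coeff_def \<kappa>_def [symmetric]
    by (simp add: divide_inverse mult_ac)
qed

lemma entire_coeffs_scale:
  assumes "entire_coeffs a"
  shows "entire_coeffs (\<lambda>n. a n * Z ^ n)"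
proof -
  have "summable (\<lambda>n. a n * Z ^ n * X ^ n)" for X :: complex
    using assms unfolding entire_coeffs_def
    by (metis (no_types, lifting) ext mult.assoc power_mult_distrib)
  then show ?thesis by (simp add: entire_coeffs_def)
qed

lemma powr_divide_real:
  assumes "x > 0" "Re s > 0"
  shows "(of_real x / s) powr of_real \<nu> = of_real (x powr \<nu>) * s powr (- of_real \<nu>)"
proof -
  have "(of_real x * inverse s) powr of_real \<nu> = of_real x powr of_real \<nu> * inverse s powr of_real \<nu>"
    by (rule powr_times_real_left) (use assms in auto)
  moreover have "Ln (inverse s) = - Ln s"
    using assms by (intro Ln_inverse) (auto simp: complex_nonpos_Reals_iff)
  then have "inverse s powr of_real \<nu> = s powr (- of_real \<nu>)"
    using assms by (auto simp: powr_def)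
  ultimately show ?thesis
    using assms by (simp add: divide_inverse powr_of_real)
qed

theorem theorem6:
  fixes x \<eta> \<nu> k q :: real
    and \<sigma> \<mu> \<xi> \<zeta> \<theta> l m s w :: complex
    and f :: "real \<Rightarrow> real \<Rightarrow> complex" and dom_f :: "real \<Rightarrow> real set"
    and g :: "real \<Rightarrow> complex" and as bs :: "(complex \<times> real) list"
  defines "f \<equiv> \<lambda>z t. complex_of_real t powr \<mu> *
                  k_mittag_leffler k \<xi> \<zeta> \<theta> q (of_real ((t * z) powr \<nu>))"
    and "dom_f \<equiv> \<lambda>z. {t. summable
                  (k_mittag_leffler_term k \<xi> \<zeta> \<theta> q (of_real ((t * z) powr \<nu>)))}"
    and "g \<equiv> \<lambda>z. complex_of_real z powr (l - 1) * frac_deriv \<eta> \<sigma> (f z) x"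
    and "as \<equiv> [(\<theta> / of_real k, q), (\<mu> / of_real \<eta> + 1, \<nu> / \<eta>), (l, \<nu>)]"
    and "bs \<equiv> [(\<zeta> / of_real k, Re (\<xi> / of_real k)), (\<mu> / of_real \<eta> - \<sigma> + 1, \<nu> / \<eta>)]"
    and "w \<equiv> complex_of_real k powr (of_real q - \<xi> / of_real k) *
                  (of_real x / s) powr of_real \<nu>"
  assumes "x > 0" and "q > 0"
    and "Re \<sigma> > 0" and "Re \<xi> > 0" and "Re \<zeta> > 0" and "Re \<theta> > 0" and "Re \<mu> > 0"
    and "Re l > 0" and "Re m > 0" and "Re s > 0" and "\<eta> > 0"
    and "\<xi> / of_real k \<in> \<real>" and "Re (\<xi> / of_real k) > 0"
    and "\<nu> / \<eta> > 0" and "\<nu> > 0"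
    and "1 + Re (\<xi> / of_real k) - q - \<nu> \<ge> 0"
    and "\<And>z. z > 0 \<Longrightarrow> frac_deriv_defined (dom_f z) \<eta> \<sigma> (f z) x"
    and "laplace_converges g s"
    and "summable (fox_wright_term as bs w)"
  shows "laplace g s =
           (-1) powr (- \<sigma>) *
           (of_real x powr (\<mu> - \<sigma> * of_real \<eta>) / s powr l) *
           (of_real \<eta> powr \<sigma> / Gamma (\<theta> / of_real k)) *
           of_real k powr (1 - \<zeta> / of_real k) *
           fox_wright as bs w"
proof -
  note x = \<open>x > 0\<close> and \<eta> = \<open>\<eta> > 0\<close> and \<nu> = \<open>\<nu> > 0\<close> and s = \<open>Re s > 0\<close>
  have k: "k > 0"
    using \<open>Re (\<xi> / of_real k) > 0\<close> \<open>Re \<xi> > 0\<close> by (simp add: Re_divide_of_real zero_less_divide_iff)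
  have \<rho>: "\<xi> / of_real k = of_real (Re (\<xi> / of_real k))"
    using \<open>\<xi> / of_real k \<in> \<real>\<close> by (rule of_real_Re [symmetric])
  define e where "e = ml_coeff k \<xi> \<zeta> \<theta> q"
  note ml_term = k_mittag_leffler_term_eq[OF k, of \<xi> \<zeta> \<theta> q, folded e_def]
  have entire_e: "entire_coeffs e"
    unfolding entire_coeffs_def
  proof
    fix X :: complex
    \<comment> \<open>The derivative is defined for every \<open>z > 0\<close>, so \<open>(x * z) powr \<nu>\<close> may exceed any bound.\<close>
    define r where "r = norm X + 1"
    define z where "z = r powr (1 / \<nu>) / x"
    have r: "r > 0" by (simp add: r_def add_nonneg_pos)
    then have z: "z > 0" using x by (simp add: z_def)
    from assms(23)[OF z] have "x \<in> dom_f z"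
      using x by (auto simp: frac_deriv_defined_def)
    moreover have "(x * z) powr \<nu> = r"
      using x r \<nu> by (simp add: z_def powr_powr)
    ultimately have "summable (\<lambda>n. e n * complex_of_real r ^ n)"
      by (simp add: dom_f_def ml_term [abs_def])
    then show "summable (\<lambda>n. e n * X ^ n)"
      by (rule powser_inside) (simp add: r_def)
  qed
  have f_gen_powser: "f z t = gen_powser \<mu> \<nu> (\<lambda>n. e n * of_real (z powr \<nu>) ^ n) t" if "t > 0" "z > 0" for z t
    using that by (simp add: f_def k_mittag_leffler_def ml_term gen_powser_def powr_mult power_mult_distrib mult_ac)
  define p where "p n = (\<mu> + of_real \<nu> * of_nat n) / of_real \<eta>" for n
  define d where "d n = Gamma (p n + 1) * rGamma (p n - \<sigma> + 1) * e n" for n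
  note fd = frac_deriv_gen_powser[OF \<eta> \<nu> x _ \<open>Re \<sigma> > 0\<close> entire_coeffs_scale[OF entire_e] f_gen_powser, folded p_def]
  have \<mu>: "- \<eta> < Re \<mu>" using \<open>Re \<mu> > 0\<close> \<eta> by simp
  have entire_d: "entire_coeffs d"
    using fd(2)[OF \<mu>, of 1] by (simp add: d_def [abs_def])
  define c where "c n = d n * of_real (x powr \<nu>) ^ n" for n
  have entire_c: "entire_coeffs c"
    unfolding c_def by (rule entire_coeffs_scale[OF entire_d])
  define C where "C = (- 1) powr (- \<sigma>) * of_real \<eta> powr \<sigma> * of_real x powr (\<mu> - of_real \<eta> * \<sigma>)"
  have C: "C \<noteq> 0" using x \<eta> by (simp add: C_def)
  have g_gen_powser: "g z = C * gen_powser (l - 1) \<nu> c z" if "z > 0" for z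
  proof -
    have "frac_deriv \<eta> \<sigma> (f z) x = C * (\<Sum>n. c n * of_real (z powr \<nu>) ^ n)"
      using fd(1)[OF \<mu> _ that] that by (simp add: C_def gen_powser_def c_def d_def mult_ac)
    then show ?thesis
      by (simp add: g_def gen_powser_def mult_ac)
  qed

  define K where "K = of_real k powr (1 - \<zeta> / of_real k) / Gamma (\<theta> / of_real k)"
  have fw: "c n * Gamma (l + of_real \<nu> * of_nat n) * (s powr (- of_real \<nu>)) ^ n = K * fox_wright_term as bs w n" for n
  proof -
    have w: "w ^ n = (of_real k powr (of_real q - \<xi> / of_real k)) ^ n * of_real (x powr \<nu>) ^ n * (s powr (- of_real \<nu>)) ^ n"
      unfolding w_def powr_divide_real[OF x s] by (simp add: power_mult_distrib)
    have p: "\<mu> / of_real \<eta> + 1 + of_real (\<nu> / \<eta>) * of_nat n = p n + 1"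
      "\<mu> / of_real \<eta> - \<sigma> + 1 + of_real (\<nu> / \<eta>) * of_nat n = p n - \<sigma> + 1"
      by (simp_all add: p_def add_divide_distrib)
    have "fox_wright_term as bs w n =
        (Gamma (\<theta> / of_real k + of_real q * of_nat n) * (Gamma (p n + 1) * Gamma (l + of_real \<nu> * of_nat n))) *
        (rGamma (\<zeta> / of_real k + \<xi> / of_real k * of_nat n) * rGamma (p n - \<sigma> + 1)) * (w ^ n / fact n)"
      unfolding fox_wright_term_def as_def bs_def p [symmetric]
      by (simp only: list.map prod_list.Nil prod_list.Cons prod.case mult_1_right \<rho> [symmetric])
    then show ?thesis
      unfolding w c_def d_def e_def ml_coeff_def K_def [symmetric]
      by (simp only: divide_inverse mult_ac)
  qed
  have int: "(\<lambda>z. exp (- s * of_real z) * gen_powser (l - 1) \<nu> c z) integrable_on {0<..}"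
  proof -
    have "(\<lambda>z. (1 / C) * (exp (- s * of_real z) * g z)) integrable_on {0<..}"
      using \<open>laplace_converges g s\<close> unfolding laplace_converges_def by (rule integrable_on_mult_right)
    then show ?thesis
      by (rule integrable_eq) (use C in \<open>simp add: g_gen_powser\<close>)
  qed
  have "laplace g s = integral {0<..} (\<lambda>z. C * (exp (- s * of_real z) * gen_powser (l - 1) \<nu> c z))"
    unfolding laplace_def by (intro integral_cong) (simp add: g_gen_powser)
  also have "\<dots> = C * integral {0<..} (\<lambda>z. exp (- s * of_real z) * gen_powser (l - 1) \<nu> c z)"
    by simp
  also have "\<dots> = C * (s powr (- l) * (\<Sum>n. K * fox_wright_term as bs w n))"
    using laplace_gen_powser[OF \<open>Re l > 0\<close> s \<nu> entire_c _ int] summable_mult[OF \<open>summable (fox_wright_term as bs w)\<close>, of K]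
    by (simp only: fw)
  also have "(\<Sum>n. K * fox_wright_term as bs w n) = K * fox_wright as bs w"
    unfolding fox_wright_def by (rule suminf_mult[OF \<open>summable (fox_wright_term as bs w)\<close>])
  finally show ?thesis
    by (simp add: C_def K_def powr_minus divide_inverse mult_ac)
qed

end
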